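(* Let $f:\mathbb{N}\to[-1,1]$ be a completely multiplicative function that is small on average, i.e. $\sum_{n\le x}f(n)=o(x^{1-\delta})$ as $x\to\infty$ for some $\delta>0$, and let $F(s)=\sum_{n=1}^\infty f(n)n^{-s}$ be its Dirichlet series. Suppose $F(1)\neq 0$. Then the following are equivalent: (i) there exists $\epsilon$ with $0<\epsilon\le\delta$ such that $F(s)\neq 0$ for all $s\in\mathbb{C}$ with $\mathrm{Re}(s)>1-\epsilon$; (ii) there exists $0\le\sigma<1$ such that the partial sums $\sum_{p\le x}f(p)p^{-\sigma}$ (over primes $p$) change sign only for a finite number of integers $x$.
   Context: $p$ denotes a generic prime number. Completely multiplicative means $f(1)=1$ and $f(mn)=f(m)f(n)$ for all positive integers $m,n$. When $\sum_{n\le x}f(n)=o(x^{1-\delta})$, the Dirichlet series $F(s)$ converges and is analytic in the half plane $\mathrm{Re}(s)>1-\delta$. Saying that the partial sums $A(x)=\sum_{p\le x}f(p)p^{-\sigma}$ change sign only for a finite number of integers $x$ means that there is $x_0>0$ such that either $A(x)\ge 0$ for all $x\ge x_0$, or $A(x)\le 0$ for all $x\ge x_0$. *)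

theory Defs
  imports
    "HOL-Complex_Analysis.Complex_Analysis"
    "HOL-Library.Landau_Symbols"
    "HOL-Computational_Algebra.Primes"
begin

text \<open>
  Arithmetic functions are defined on the positive integers; they are represented by functions
  on \<^typ>\<open>nat\<close> whose value at 0 is never used.
\<close>

definition completely_multiplicative :: "(nat \<Rightarrow> real) \<Rightarrow> bool" where
  "completely_multiplicative f \<longleftrightarrow>
     f 1 = 1 \<and> (\<forall>m n. m > 0 \<longrightarrow> n > 0 \<longrightarrow> f (m * n) = f m * f n)"

definition small_on_average :: "(nat \<Rightarrow> real) \<Rightarrow> real \<Rightarrow> bool" where
  "small_on_average f \<delta> \<longleftrightarrow>
     (\<lambda>x::real. \<Sum>n | 1 \<le> n \<and> real n \<le> x. f n) \<in> o[at_top](\<lambda>x. x powr (1 - \<delta>))"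

text \<open>
  The series is summed in the natural order of the terms, since it need not converge absolutely.
  It converges for \<open>Re s > 1 - \<delta>\<close> whenever \<open>small_on_average f \<delta>\<close>; where it diverges, the value
  carries no meaning.
\<close>

definition dirichlet_series :: "(nat \<Rightarrow> real) \<Rightarrow> complex \<Rightarrow> complex" where
  "dirichlet_series f s = (\<Sum>n. of_real (f (Suc n)) * of_nat (Suc n) powr (- s))"

definition prime_partial_sum :: "(nat \<Rightarrow> real) \<Rightarrow> real \<Rightarrow> real \<Rightarrow> real" where
  "prime_partial_sum f \<sigma> x = (\<Sum>p | prime p \<and> real p \<le> x. f p * real p powr (- \<sigma>))"

definition finitely_many_sign_changes :: "(real \<Rightarrow> real) \<Rightarrow> bool" where
  "finitely_many_sign_changes A \<longleftrightarrow>
     (\<exists>x0>0. (\<forall>x\<ge>x0. A x \<ge> 0) \<or> (\<forall>x\<ge>x0. A x \<le> 0))"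

end

theory Submission
  imports Defs
begin

text \<open>
  On \<open>Re s > 1\<close> the Euler product gives \<open>F = exp (P + H)\<close> with \<open>P s\<close> the series of
  \<open>f p / p\<^sup>s\<close> over primes and \<open>H\<close> holomorphic and bounded on \<open>Re s > 3/4\<close>.

  If \<open>F\<close> has no zeros in \<open>Re s > 1 - \<epsilon>\<close>, its logarithm grows at most linearly there
  (Borel--Caratheodory, as \<open>F s\<close> is \<open>O(\<bar>s\<bar>)\<close> by partial summation). Newman's contour argument then shows that
  the tails of the series \<open>P 1\<close> are \<open>O(N\<^bsup>-\<theta>\<^esup>)\<close>, so \<open>P\<close> converges on \<open>Re s > 1 - \<theta>\<close>.
  Unless \<open>f\<close> vanishes at all primes, \<open>P \<sigma> \<noteq> 0\<close> for some \<open>\<sigma>\<close> in \<open>(1 - \<theta>, 1)\<close>, and the partial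
  sums of \<open>P \<sigma>\<close> eventually have the sign of their limit.

  Conversely, if the partial sums \<open>A n\<close> of \<open>P \<sigma>\<close> eventually have constant sign, then summation by
  parts expresses \<open>P\<close> through the Dirichlet series with coefficients \<open>A n\<close>. Since \<open>F 1 \<noteq> 0\<close>,
  \<open>P = log F - H\<close> continues past the point 1, and Landau's theorem makes this series converge, and
  \<open>P\<close> continue, on a half plane \<open>Re s > 1 - \<epsilon>\<close>, where \<open>F = exp (P + H)\<close> cannot vanish.
\<close>

section \<open>Dirichlet series and their partial sums\<close>

text \<open>Neither direction can work with the prime series alone. Holomorphic continuation does
  not by itself make a series with signed coefficients converge, so the first direction needs a
  quantitative tool: Newman's argument uses only coefficients bounded by 1 and linear growth in a
  strip, works at the single point 1, and the rate found there is what yields convergence further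
  left. A nonzero \<open>F 1\<close> gives a logarithm only on a small disc around 1, which is why
  Landau's theorem is needed in local form; it turns this disc into a half plane and so excludes
  nonreal zeros as well. The abscissa 3/4 stands for any number above 1/2, where the squares of the
  terms \<open>1/p^s\<close> are absolutely summable; it caps the widths at 1/4.\<close>

lemma norm_of_nat_powr:
  "n > 0 \<Longrightarrow> norm ((of_nat n :: complex) powr s) = real n powr Re s"
  by (subst norm_powr_real_powr) auto

text \<open>Mean value inequality along the segment from \<open>x\<close> to \<open>y\<close>. Since
  \<open>Re s \<ge> -1\<close>, the modulus of \<open>t powr (-s-1)\<close> is largest at the left
  endpoint.\<close>

lemma norm_powr_diff_le:
  fixes s :: complex
  assumes "0 < x" "x \<le> y" "Re s \<ge> -1"
  shows "norm (of_real x powr (-s) - of_real y powr (-s)) \<le> norm s * x powr (- Re s - 1) * (y - x)"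
proof -
  have "norm (of_real x powr (-s) - of_real y powr (-s))
          \<le> norm s * x powr (- Re s - 1) * norm (of_real x - of_real y :: complex)"
  proof (rule field_differentiable_bound[where S = "complex_of_real ` {x..y}"
              and f' = "\<lambda>z. - s * z powr (- s - 1)"])
    show "convex (complex_of_real ` {x..y})"
      by (intro convex_linear_image) (auto simp: linear_iff scaleR_conv_of_real)
    fix z assume "z \<in> complex_of_real ` {x..y}"
    then obtain t where t: "z = of_real t" "x \<le> t" "t \<le> y" by auto
    have "t > 0" using t assms by simp
    show "((\<lambda>z. z powr - s) has_field_derivative - s * z powr (- s - 1)) (at z within complex_of_real ` {x..y})"
      using \<open>t > 0\<close> t by (intro has_field_derivative_at_within[OF has_field_derivative_powr]) auto
    have "norm (z powr (- s - 1)) = t powr (- Re s - 1)"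
      using \<open>t > 0\<close> t by (subst norm_powr_real_powr) auto
    also have "\<dots> \<le> x powr (- Re s - 1)"
      using assms t by (intro powr_mono2') auto
    finally show "norm (- s * z powr (- s - 1)) \<le> norm s * x powr (- Re s - 1)"
      by (simp add: norm_mult mult_left_mono)
  qed (use assms in auto)
  also have "norm (of_real x - of_real y :: complex) = y - x"
    using assms(2) by (metis abs_minus_commute abs_of_nonneg diff_ge_0_iff_ge norm_of_real of_real_diff)
  finally show ?thesis .
qed

text \<open>The mean value inequality is applied to \<open>z powr (-w)\<close> plus the linear
  function cancelling its derivative at \<open>x\<close>; the remaining derivative is a difference
  of powers with exponent \<open>-w-1\<close>, bounded by the previous lemma. The extra power of
  \<open>x\<close> gained here is the source of the wide half plane for
  \<open>abel_error\<close>.\<close>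

lemma norm_powr_taylor_le:
  fixes w :: complex
  assumes "0 < x" "x \<le> y" "Re w \<ge> -2"
  shows "norm (of_real x powr (-w) - of_real y powr (-w) - w * of_real x powr (-w-1) * of_real (y - x))
           \<le> norm w * norm (w + 1) * x powr (- Re w - 2) * (y - x)\<^sup>2"
proof -
  define g where "g = (\<lambda>z. z powr (-w) + w * of_real x powr (-w-1) * z)"
  have "norm (g (of_real x) - g (of_real y))
          \<le> norm w * norm (w + 1) * x powr (- Re w - 2) * (y - x) * norm (of_real x - of_real y :: complex)"
  proof (rule field_differentiable_bound[where S = "complex_of_real ` {x..y}"
              and f' = "\<lambda>z. - w * z powr (- w - 1) + w * of_real x powr (-w-1)"])
    show "convex (complex_of_real ` {x..y})"
      by (intro convex_linear_image) (auto simp: linear_iff scaleR_conv_of_real)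
    fix z assume "z \<in> complex_of_real ` {x..y}"
    then obtain t where t: "z = of_real t" "x \<le> t" "t \<le> y" by auto
    have "t > 0" using t assms by simp
    show "(g has_field_derivative - w * z powr (- w - 1) + w * of_real x powr (-w-1)) (at z within complex_of_real ` {x..y})"
    proof -
      have "((\<lambda>z. z powr (-w)) has_field_derivative - w * z powr (- w - 1)) (at z)"
        using \<open>t > 0\<close> t by (intro has_field_derivative_powr) auto
      moreover have "((\<lambda>z. w * of_real x powr (-w-1) * z) has_field_derivative w * of_real x powr (-w-1)) (at z)"
        using DERIV_cmult[OF DERIV_ident] by simp
      ultimately show ?thesis
        unfolding g_def by (rule has_field_derivative_at_within[OF DERIV_add])
    qed
    have "norm (of_real x powr (-(w+1)) - of_real t powr (-(w+1)))
            \<le> norm (w+1) * x powr (- Re (w+1) - 1) * (t - x)"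
      using assms t by (intro norm_powr_diff_le) auto
    also have "\<dots> \<le> norm (w+1) * x powr (- Re (w+1) - 1) * (y - x)"
      using t by (intro mult_left_mono) auto
    finally have *: "norm (of_real x powr (-w-1) - z powr (-w-1)) \<le> norm (w+1) * x powr (- Re w - 2) * (y - x)"
      by (simp add: t diff_diff_eq)
    have "norm (- w * z powr (- w - 1) + w * of_real x powr (-w-1)) = norm w * norm (of_real x powr (-w-1) - z powr (-w-1))"
      by (simp flip: norm_mult add: algebra_simps)
    also have "\<dots> \<le> norm w * (norm (w+1) * x powr (- Re w - 2) * (y - x))"
      using * by (intro mult_left_mono) auto
    finally show "norm (- w * z powr (- w - 1) + w * of_real x powr (-w-1)) 
        \<le> norm w * norm (w + 1) * x powr (- Re w - 2) * (y - x)"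
      by (simp add: mult_ac)
  qed (use assms in auto)
  also have "norm (of_real x - of_real y :: complex) = y - x"
    using assms(2) by (metis abs_minus_commute abs_of_nonneg diff_ge_0_iff_ge norm_of_real of_real_diff)
  finally show ?thesis
    by (simp add: g_def algebra_simps power2_eq_square)
qed

lemma summable_Suc_powr: "\<beta> < -1 \<Longrightarrow> summable (\<lambda>n. real (Suc n) powr \<beta>)"
  using summable_real_powr_iff[of \<beta>] by (subst summable_Suc_iff) simp

text \<open>Weierstrass M-test with a majorant that may depend on the ball around \<open>z\<close>:
  bounds for Dirichlet series worsen for large \<open>norm s\<close> and near the boundary
  line.\<close>

lemma holomorphic_suminf:
  fixes g :: "nat \<Rightarrow> complex \<Rightarrow> complex"
  assumes "open S" and g: "\<And>n. g n holomorphic_on S"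
    and bd: "\<And>z. z \<in> S \<Longrightarrow> \<exists>d>0. \<exists>M. summable M \<and> (\<forall>n. \<forall>y\<in>ball z d \<inter> S. norm (g n y) \<le> M n)"
  shows "(\<lambda>z. \<Sum>n. g n z) holomorphic_on S"
proof -
  obtain G where G: "\<forall>z\<in>S. (\<lambda>n. g n z) sums G z \<and> G field_differentiable (at z)"
  proof (rule series_differentiable_comparison_complex[OF \<open>open S\<close>])
    show "g n field_differentiable (at z)" if "z \<in> S" for n z
      using g \<open>open S\<close> that by (rule holomorphic_on_imp_differentiable_at)
    show "\<exists>d h. 0 < d \<and> summable h \<and> range h \<subseteq> \<real>\<^sub>\<ge>\<^sub>0 \<and> (\<forall>\<^sub>F n in sequentially. \<forall>y\<in>ball z d \<inter> S. cmod (g n y) \<le> cmod (h n))"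
      if z: "z \<in> S" for z
    proof -
      obtain d M where d: "d > 0" "summable M" "\<And>n y. y \<in> ball z d \<inter> S \<Longrightarrow> norm (g n y) \<le> M n"
        using bd[OF z] by blast
      have M0: "M n \<ge> 0" for n
        using order_trans[OF norm_ge_zero d(3)[of z n]] z d(1) by simp
      show ?thesis
        using d M0 by (intro exI[of _ d] exI[of _ "\<lambda>n. complex_of_real (M n)"])
          (auto simp: summable_of_real)
    qed
  qed
  have "G holomorphic_on S"
    using G by (auto simp: holomorphic_on_def intro: field_differentiable_at_within)
  then show ?thesis
    using G by (auto intro: holomorphic_transform simp: sums_iff)
qed

lemma abel_summation:
  fixes b u :: "nat \<Rightarrow> 'a::comm_ring"
  shows "(\<Sum>k<n. b (Suc k) * u (Suc k)) =
    (\<Sum>k<n. sum b {1..Suc k} * (u (Suc k) - u (Suc (Suc k)))) + sum b {1..n} * u (Suc n)"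
  by (induction n) (auto simp: algebra_simps)

context
  fixes a :: "nat \<Rightarrow> real" and C \<alpha> :: real
  assumes bound: "\<And>n. n \<ge> 1 \<Longrightarrow> \<bar>sum a {1..n}\<bar> \<le> C * real n powr \<alpha>" and \<alpha>: "\<alpha> \<ge> 0"
begin

lemma dirichlet_series_abel_term_le:
  assumes "Re s > \<alpha>"
  shows "norm (of_real (sum a {1..Suc n}) * (of_nat (Suc n) powr (-s) - of_nat (Suc (Suc n)) powr (-s)))
          \<le> C * norm s * real (Suc n) powr (\<alpha> - Re s - 1)"
proof -
  have "norm (of_real (real (Suc n)) powr (-s) - of_real (real (Suc (Suc n))) powr (-s))
          \<le> norm s * real (Suc n) powr (- Re s - 1) * (real (Suc (Suc n)) - real (Suc n))"
    using assms \<alpha> by (intro norm_powr_diff_le) auto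
  then have "\<bar>sum a {1..Suc n}\<bar> * norm ((of_nat (Suc n) powr (-s) - of_nat (Suc (Suc n)) powr (-s)))
         \<le> (C * real (Suc n) powr \<alpha>) * (norm s * real (Suc n) powr (- Re s - 1))"
    using bound[of "Suc n"] by (intro mult_mono) (auto intro: order_trans[OF abs_ge_zero])
  also have "\<dots> = C * norm s * (real (Suc n) powr \<alpha> * real (Suc n) powr (- Re s - 1))"
    by (simp add: mult_ac)
  also have "real (Suc n) powr \<alpha> * real (Suc n) powr (- Re s - 1) = real (Suc n) powr (\<alpha> - Re s - 1)"
    by (subst powr_add[symmetric]) (simp add: algebra_simps)
  finally show ?thesis by (simp only: norm_mult norm_of_real)
qed

text \<open>The transformed terms are of order \<open>n powr (\<alpha> - Re s - 1)\<close>, so they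
  converge absolutely even where the original series does not; the boundary term is of order
  \<open>n powr (\<alpha> - Re s)\<close> and disappears in the limit.\<close>

lemma dirichlet_series_sums_abel:
  assumes s: "Re s > \<alpha>"
  shows "(\<lambda>n. of_real (a (Suc n)) * of_nat (Suc n) powr (- s)) sums
     (\<Sum>n. of_real (sum a {1..Suc n}) * (of_nat (Suc n) powr (-s) - of_nat (Suc (Suc n)) powr (-s)))"
    (is "_ sums (\<Sum>n. ?g n)")
proof -
  have "summable (\<lambda>n. C * norm s * real (Suc n) powr (\<alpha> - Re s - 1))"
    using s by (intro summable_mult summable_Suc_powr) auto
  then have "summable ?g"
    by (rule summable_comparison_test'[of _ 0]) (use dirichlet_series_abel_term_le[OF s] in auto)
  then have 1: "(\<lambda>n. \<Sum>k<n. ?g k) \<longlonglongrightarrow> (\<Sum>n. ?g n)"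
    by (rule summable_LIMSEQ)
  have 2: "(\<lambda>n. of_real (sum a {1..n}) * of_nat (Suc n) powr (-s)) \<longlonglongrightarrow> (0::complex)"
  proof (rule Lim_null_comparison)
    show "(\<lambda>n. C * real n powr (\<alpha> - Re s)) \<longlonglongrightarrow> 0"
      using s by (intro tendsto_mult_right_zero tendsto_neg_powr filterlim_real_sequentially) auto
    show "\<forall>\<^sub>F n in sequentially. norm (of_real (sum a {1..n}) * of_nat (Suc n) powr (-s) :: complex)
             \<le> C * real n powr (\<alpha> - Re s)"
      using eventually_ge_at_top[of 1]
    proof eventually_elim
      case (elim n)
      have "norm (of_real (sum a {1..n}) * of_nat (Suc n) powr (-s) :: complex)
             = \<bar>sum a {1..n}\<bar> * real (Suc n) powr (- Re s)"
        by (simp add: norm_mult norm_of_nat_powr del: of_nat_Suc of_real_sum)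
      also have "\<dots> \<le> (C * real n powr \<alpha>) * real n powr (- Re s)"
        using bound[OF elim] elim s \<alpha> by (intro mult_mono powr_mono2') (auto intro: order_trans[OF abs_ge_zero])
      also have "\<dots> = C * real n powr (\<alpha> - Re s)"
        by (simp add: powr_add[symmetric])
      finally show ?case .
    qed
  qed
  have "(\<lambda>n. \<Sum>k<n. of_real (a (Suc k)) * of_nat (Suc k) powr (- s)) \<longlonglongrightarrow> (\<Sum>n. ?g n)"
    using tendsto_add[OF 1 2] abel_summation[of "\<lambda>k. complex_of_real (a k)" "\<lambda>k. of_nat k powr (-s)"]
    by simp
  then show ?thesis by (simp add: sums_def)
qed

lemma dirichlet_series_abel:
  "Re s > \<alpha> \<Longrightarrow> dirichlet_series a s =
     (\<Sum>n. of_real (sum a {1..Suc n}) * (of_nat (Suc n) powr (-s) - of_nat (Suc (Suc n)) powr (-s)))"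
  using dirichlet_series_sums_abel[of s] unfolding dirichlet_series_def by (simp add: sums_iff)

lemma dirichlet_series_sums:
  "Re s > \<alpha> \<Longrightarrow> (\<lambda>n. of_real (a (Suc n)) * of_nat (Suc n) powr (- s)) sums dirichlet_series a s"
  using dirichlet_series_sums_abel dirichlet_series_abel by simp

text \<open>The factor \<open>norm s\<close> comes from the mean value bound for consecutive powers.
  This supplies the growth of \<open>F\<close> that Borel-Caratheodory needs.\<close>

lemma norm_dirichlet_series_le:
  assumes "\<eta> > 0" "Re s \<ge> \<alpha> + \<eta>"
  shows "norm (dirichlet_series a s) \<le> C * norm s * (\<Sum>n. real (Suc n) powr (- 1 - \<eta>))"
proof -
  have C: "C \<ge> 0" using bound[of 1] abs_ge_zero[of "sum a {1..1}"] by simp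
  have sm: "summable (\<lambda>n. C * norm s * real (Suc n) powr (- 1 - \<eta>))"
    using assms by (intro summable_mult summable_Suc_powr) auto
  have "C * norm s * real (Suc n) powr (\<alpha> - Re s - 1) \<le> C * norm s * real (Suc n) powr (- 1 - \<eta>)" for n
    using C assms by (intro mult_left_mono powr_mono) auto
  then have "norm (dirichlet_series a s) \<le> (\<Sum>n. C * norm s * real (Suc n) powr (- 1 - \<eta>))"
    using dirichlet_series_abel_term_le[of s] assms sm
    by (subst dirichlet_series_abel) (auto intro!: norm_suminf_le intro: order_trans simp del: of_nat_Suc of_real_sum)
  also have "\<dots> = C * norm s * (\<Sum>n. real (Suc n) powr (- 1 - \<eta>))"
    using assms by (intro suminf_mult summable_Suc_powr) auto
  finally show ?thesis .
qed

lemma dirichlet_series_holomorphic: "dirichlet_series a holomorphic_on {s. Re s > \<alpha>}"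
proof -
  have C: "C \<ge> 0" using bound[of 1] abs_ge_zero[of "sum a {1..1}"] by simp
  \<comment> \<open>The M-test is run on the transformed series, since the original one need not
    converge absolutely.\<close>
  have "(\<lambda>s. \<Sum>n. of_real (sum a {1..Suc n}) * (of_nat (Suc n) powr (-s) - of_nat (Suc (Suc n)) powr (-s)))
          holomorphic_on {s. Re s > \<alpha>}"
  proof (rule holomorphic_suminf)
    show "open {s. Re s > \<alpha>}" by (rule open_halfspace_Re_gt)
    fix z assume "z \<in> {s. Re s > \<alpha>}"
    \<comment> \<open>Half the distance to the boundary line, so that the ball stays in
      \<open>Re y \<ge> \<alpha> + d\<close>.\<close>
    define d where "d = (Re z - \<alpha>) / 2"
    have "d > 0" using \<open>z \<in> _\<close> by (simp add: d_def)
    have "norm (of_real (sum a {1..Suc n}) * (of_nat (Suc n) powr (-y) - of_nat (Suc (Suc n)) powr (-y)))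
        \<le> C * (norm z + d) * real (Suc n) powr (- 1 - d)" if "y \<in> ball z d" "Re y > \<alpha>" for n y
    proof -
      have "norm (z - y) < d" using that by (simp add: dist_norm)
      then have 1: "norm y \<le> norm z + d" using norm_triangle_ineq2[of y z] by (simp add: norm_minus_commute)
      have "Re z - Re y \<le> norm (z - y)" using complex_Re_le_cmod[of "z - y"] by simp
      then have "Re y \<ge> \<alpha> + d" using \<open>norm (z - y) < d\<close> by (simp add: d_def field_simps)
      then have "C * norm y * real (Suc n) powr (\<alpha> - Re y - 1) \<le> C * (norm z + d) * real (Suc n) powr (- 1 - d)"
        using C 1 \<open>d > 0\<close> by (intro mult_mono powr_mono) auto
      then show ?thesis using dirichlet_series_abel_term_le[OF that(2), of n] by linarith
    qed
    moreover have "summable (\<lambda>n. C * (norm z + d) * real (Suc n) powr (- 1 - d))"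
      using \<open>d > 0\<close> by (intro summable_mult summable_Suc_powr) auto
    ultimately show "\<exists>d>0. \<exists>M. summable M \<and> (\<forall>n. \<forall>y\<in>ball z d \<inter> {s. \<alpha> < Re s}.
       cmod (of_real (sum a {1..Suc n}) * (of_nat (Suc n) powr (-y) - of_nat (Suc (Suc n)) powr (-y))) \<le> M n)"
      using \<open>d > 0\<close> by (intro exI[of _ d] conjI exI[of _ "\<lambda>n. C * (norm z + d) * real (Suc n) powr (- 1 - d)"]) auto
  qed (auto intro!: holomorphic_intros simp del: of_nat_Suc)
  then show ?thesis
    by (rule holomorphic_transform) (use dirichlet_series_abel in auto)
qed

end

lemma abs_sum_powr_le:
  assumes "\<And>n. n \<ge> 1 \<Longrightarrow> \<bar>a n\<bar> \<le> C * real n powr \<kappa>" "\<kappa> \<ge> 0" "n \<ge> 1"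
  shows "\<bar>sum a {1..n}\<bar> \<le> C * real n powr (\<kappa> + 1)"
proof -
  have C: "C \<ge> 0" using assms(1)[of 1] by simp
  have "\<bar>sum a {1..n}\<bar> \<le> (\<Sum>k=1..n. \<bar>a k\<bar>)" by (rule sum_abs)
  also have "\<dots> \<le> (\<Sum>k=1..n. C * real n powr \<kappa>)"
    using C assms by (intro sum_mono order_trans[OF assms(1)] mult_left_mono powr_mono2) auto
  also have "\<dots> = C * real n powr (\<kappa> + 1)"
    using assms(3) by (simp add: powr_add)
  finally show ?thesis .
qed

section \<open>The Euler product\<close>

text \<open>Sieve of Eratosthenes. For prime \<open>N\<close>, the step to \<open>Suc N\<close>
  removes the multiples of \<open>N\<close>; these are exactly \<open>N\<close> times the current
  set, so they carry \<open>t N\<close> times the current sum. For other \<open>N\<close> the set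
  does not change.\<close>

lemma infsum_sieve:
  fixes t :: "nat \<Rightarrow> complex"
  assumes mult: "\<And>m n. m > 0 \<Longrightarrow> n > 0 \<Longrightarrow> t (m * n) = t m * t n"
    and summ: "t summable_on {1..}"
  shows "infsum t {n. n \<ge> 1 \<and> (\<forall>p. prime p \<longrightarrow> p dvd n \<longrightarrow> p \<ge> N)} =
           (\<Prod>p | prime p \<and> p < N. 1 - t p) * infsum t {1..}"
proof (induction N)
  case 0
  have "{n::nat. n \<ge> 1 \<and> (\<forall>p. prime p \<longrightarrow> p dvd n \<longrightarrow> p \<ge> 0)} = {1..}" by auto
  then show ?case by simp
next
  case (Suc N)
  define S where "S = (\<lambda>N. {n::nat. n \<ge> 1 \<and> (\<forall>p. prime p \<longrightarrow> p dvd n \<longrightarrow> p \<ge> N)})"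
  have IH: "infsum t (S N) = (\<Prod>p | prime p \<and> p < N. 1 - t p) * infsum t {1..}"
    using Suc by (simp add: S_def)
  have "infsum t (S (Suc N)) = (\<Prod>p | prime p \<and> p < Suc N. 1 - t p) * infsum t {1..}"
  proof (cases "prime N")
    case False
    have "S (Suc N) = S N" 
      using False by (auto simp: S_def Suc_le_eq order_le_less)
    moreover have "{p. prime p \<and> p < Suc N} = {p. prime p \<and> p < N}"
      using False by (auto simp: less_Suc_eq)
    ultimately show ?thesis using IH by simp
  next
    case True
    have N: "N > 0" using True by (simp add: prime_gt_0_nat)
    have sm: "t summable_on S M" for M
      by (rule summable_on_subset_banach[OF summ]) (auto simp: S_def)
    have split: "S N = S (Suc N) \<union> (*) N ` S N"
    proof (intro equalityI subsetI)
      fix n assume n: "n \<in> S N"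
      show "n \<in> S (Suc N) \<union> (*) N ` S N"
      proof (cases "N dvd n")
        case True
        then obtain m where "n = N * m" by auto
        with n have "m \<in> S N" by (auto simp: S_def Suc_le_eq)
        with \<open>n = N * m\<close> show ?thesis by auto
      next
        case False
        with n have "n \<in> S (Suc N)"
          by (auto simp: S_def Suc_le_eq order_le_less)
        then show ?thesis by simp
      qed
    next
      fix n assume "n \<in> S (Suc N) \<union> (*) N ` S N"
      then show "n \<in> S N"
      proof
        assume "n \<in> S (Suc N)" then show ?thesis by (auto simp: S_def Suc_le_eq order_le_less)
      next
        assume "n \<in> (*) N ` S N"
        then obtain m where m: "m \<in> S N" "n = N * m" by auto
        have "p \<ge> N" if "prime p" "p dvd n" for p
        proof -
          have "p dvd N \<or> p dvd m" using that m by (simp add: prime_dvd_mult_iff)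
          then show ?thesis using m that True primes_dvd_imp_eq[of p N] by (auto simp: S_def)
        qed
        then show ?thesis using m N by (auto simp: S_def)
      qed
    qed
    have disj: "S (Suc N) \<inter> (*) N ` S N = {}"
      using True by (auto simp: S_def)
    have inj: "inj_on ((*) N) (S N)" using N by (auto simp: inj_on_def)
    have "infsum t ((*) N ` S N) = infsum (t \<circ> (*) N) (S N)"
      by (rule infsum_reindex[OF inj])
    also have "\<dots> = infsum (\<lambda>n. t N * t n) (S N)"
      using mult N by (intro infsum_cong) (auto simp: S_def)
    also have "\<dots> = t N * infsum t (S N)"
      by (intro infsum_cmult_right sm)
    finally have im: "infsum t ((*) N ` S N) = t N * infsum t (S N)" .
    have "t summable_on (*) N ` S N"
      by (rule summable_on_subset_banach[OF sm[of N]]) (use split in blast)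
    then have "infsum t (S N) = infsum t (S (Suc N)) + t N * infsum t (S N)"
      using infsum_Un_disjoint[OF sm[of "Suc N"] _ disj] split im by simp
    then have "infsum t (S (Suc N)) = (1 - t N) * infsum t (S N)"
      by (simp add: algebra_simps)
    moreover have "{p. prime p \<and> p < Suc N} = insert N {p. prime p \<and> p < N}"
      using True by (auto simp: less_Suc_eq)
    ultimately show ?thesis using IH by (simp add: mult_ac)
  qed
  then show ?case by (simp add: S_def)
qed

lemma euler_product_tendsto:
  fixes t :: "nat \<Rightarrow> complex"
  assumes mult: "\<And>m n. m > 0 \<Longrightarrow> n > 0 \<Longrightarrow> t (m * n) = t m * t n"
    and t01: "t 0 = 0" "t 1 = 1" and summ: "summable (\<lambda>n. norm (t n))"
  shows "(\<lambda>N. (\<Prod>p | prime p \<and> p < N. 1 - t p) * (\<Sum>n. t n)) \<longlonglongrightarrow> 1"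
proof -
  define S where "S = (\<lambda>N. {n::nat. n \<ge> 1 \<and> (\<forall>p. prime p \<longrightarrow> p dvd n \<longrightarrow> p \<ge> N)})"
  have abs: "(\<lambda>n. norm (t n)) summable_on UNIV"
    using summ by (subst summable_on_UNIV_nonneg_real_iff) auto
  then have nsm: "(\<lambda>n. norm (t n)) summable_on A" for A
    by (rule summable_on_subset_banach) auto
  then have sm: "t summable_on A" for A
    by (rule abs_summable_summable)
  have "(\<Sum>n. t n) = infsum t UNIV"
    using has_sum_imp_sums[of t "infsum t UNIV"] sm by (simp add: has_sum_infsum sums_iff)
  also have "\<dots> = infsum t {1..}"
    using t01 by (intro infsum_cong_neutral) (auto simp: not_less_eq_eq)
  finally have eq: "(\<Prod>p | prime p \<and> p < N. 1 - t p) * (\<Sum>n. t n) = infsum t (S N)" for N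
    using infsum_sieve[of t N, OF mult sm] by (simp add: S_def)
  have S1: "S N - {1} \<subseteq> {N..}" for N
  proof
    fix n assume n: "n \<in> S N - {1}"
    then obtain p where "prime p" "p dvd n" using prime_factor_nat[of n] by auto
    with n have "N \<le> p" "p \<le> n" by (auto simp: S_def intro: dvd_imp_le)
    then show "n \<in> {N..}" by simp
  qed
  have bd: "norm (infsum t (S N) - 1) \<le> (\<Sum>n. norm (t n)) - (\<Sum>n<N. norm (t n))" for N
  proof -
    have "1 \<in> S N" by (auto simp: S_def)
    then have "infsum t (S N) - 1 = infsum t (S N - {1})"
      using infsum_Diff[OF sm sm, of "{1}" "S N"] t01 by simp
    also have "norm \<dots> \<le> infsum (\<lambda>n. norm (t n)) (S N - {1})"
      by (intro norm_infsum_bound nsm)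
    also have "\<dots> \<le> infsum (\<lambda>n. norm (t n)) {N..}"
      by (intro infsum_mono_neutral nsm) (use S1 in auto)
    also have "{N..} = UNIV - {..<N}" by auto
    also have "infsum (\<lambda>n. norm (t n)) (UNIV - {..<N}) = infsum (\<lambda>n. norm (t n)) UNIV - infsum (\<lambda>n. norm (t n)) {..<N}"
      by (intro infsum_Diff nsm) auto
    also have "infsum (\<lambda>n. norm (t n)) UNIV = (\<Sum>n. norm (t n))"
      using has_sum_imp_sums[of "\<lambda>n. norm (t n)"] nsm by (metis has_sum_infsum sums_unique)
    finally show ?thesis by simp
  qed
  have "(\<lambda>N. (\<Sum>n. norm (t n)) - (\<Sum>n<N. norm (t n))) \<longlonglongrightarrow> 0"
    using tendsto_diff[OF tendsto_const summable_LIMSEQ[OF summ], of "\<Sum>n. norm (t n)"] by simp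
  then have "(\<lambda>N. infsum t (S N) - 1) \<longlonglongrightarrow> 0"
    by (rule Lim_null_comparison[rotated]) (use bd in auto)
  then have "(\<lambda>N. infsum t (S N)) \<longlonglongrightarrow> 1"
    by (simp add: LIM_zero_iff)
  then show ?thesis by (simp add: eq)
qed

text \<open>The function \<open>H\<close>: for \<open>g\<close> supported on the primes it collects
  \<open>(g p / p^s)^k / k\<close> over all primes \<open>p\<close> and \<open>k \<ge> 2\<close>. A
  vanishing coefficient contributes nothing, as \<open>Ln 1 = 0\<close>.\<close>

definition log_remainder :: "(nat \<Rightarrow> real) \<Rightarrow> complex \<Rightarrow> complex" where
  "log_remainder g s = (\<Sum>n. - Ln (1 - of_real (g (Suc n)) * of_nat (Suc n) powr (- s))
                             - of_real (g (Suc n)) * of_nat (Suc n) powr (- s))"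

context
  fixes g :: "nat \<Rightarrow> real"
  assumes g1: "g 1 = 0" and g: "\<And>n. n \<ge> 1 \<Longrightarrow> \<bar>g n\<bar> \<le> 1"
begin

text \<open>\<open>g 1 = 0\<close> settles the term \<open>n = 0\<close>; all others have base at
  least 2, and \<open>2 powr (-3/4) < 3/4\<close>. The gap to 1 keeps \<open>1 - z\<close> off the
  branch cut of \<open>Ln\<close>.\<close>

lemma norm_euler_factor_le:
  assumes "Re s \<ge> 3/4"
  shows "norm (of_real (g (Suc n)) * of_nat (Suc n) powr (- s) :: complex) \<le> real (Suc n) powr (- 3/4)"
        "norm (of_real (g (Suc n)) * of_nat (Suc n) powr (- s) :: complex) \<le> 3/4"
proof -
  have "norm (of_real (g (Suc n)) * of_nat (Suc n) powr (- s) :: complex)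
          = \<bar>g (Suc n)\<bar> * real (Suc n) powr (- Re s)"
    by (simp add: norm_mult norm_of_nat_powr del: of_nat_Suc)
  also have "\<dots> \<le> 1 * real (Suc n) powr (- 3/4)"
    using assms g[of "Suc n"] by (intro mult_mono powr_mono) auto
  finally show *: "norm (of_real (g (Suc n)) * of_nat (Suc n) powr (- s) :: complex) \<le> real (Suc n) powr (- 3/4)" by simp
  show "norm (of_real (g (Suc n)) * of_nat (Suc n) powr (- s) :: complex) \<le> 3/4"
  proof (cases "n = 0")
    case False
    then have "real (Suc n) powr (- 3/4) \<le> 2 powr (-3/4)"
      by (intro powr_mono2') auto
    also have "\<dots> \<le> 2 powr (-1/2)" by (intro powr_mono) auto
    also have "\<dots> = 1 / sqrt 2" by (simp add: powr_minus powr_half_sqrt divide_simps)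
    also have "\<dots> \<le> 3/4"
      using real_le_rsqrt[of "4/3" 2] by (simp add: field_simps power2_eq_square)
    finally show ?thesis using * by linarith
  qed (use g1 in auto)
qed

text \<open>The logarithm has a quadratic error: squaring turns the exponent \<open>-3/4\<close>
  into the summable \<open>-3/2\<close>, and \<open>1 - norm z \<ge> 1/4\<close> gives the factor
  4.\<close>

lemma norm_log_remainder_term_le:
  assumes "Re s \<ge> 3/4"
  shows "norm (- Ln (1 - of_real (g (Suc n)) * of_nat (Suc n) powr (- s))
                - of_real (g (Suc n)) * of_nat (Suc n) powr (- s)) \<le> 4 * real (Suc n) powr (- 3/2)"
proof -
  define z :: complex where "z = of_real (g (Suc n)) * of_nat (Suc n) powr (- s)"
  have z: "norm z \<le> real (Suc n) powr (- 3/4)" "norm z \<le> 3/4"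
    using norm_euler_factor_le[OF assms, of n] by (auto simp: z_def)
  have "norm (- Ln (1 - z) - z) = norm (ln (1 + (-z)) - (-z))"
    using norm_minus_cancel[of "Ln (1 - z) + z"] by (simp del: norm_minus_cancel)
  also have "\<dots> \<le> norm (-z) ^ 2 / (1 - norm (-z))"
    using z by (intro Ln_approx_linear) auto
  also have "\<dots> \<le> (real (Suc n) powr (- 3/4))\<^sup>2 / (1/4)"
    using z by (intro frac_le power_mono) auto
  also have "(real (Suc n) powr (- 3/4))\<^sup>2 = real (Suc n) powr (- 3/2)"
    by (simp add: power2_eq_square powr_add[symmetric])
  finally show ?thesis by (simp add: z_def mult_ac)
qed

lemma summable_log_remainder:
  "Re s \<ge> 3/4 \<Longrightarrow> summable (\<lambda>n. - Ln (1 - of_real (g (Suc n)) * of_nat (Suc n) powr (- s))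
                - of_real (g (Suc n)) * of_nat (Suc n) powr (- s))"
  by (rule summable_comparison_test'[of "\<lambda>n. 4 * real (Suc n) powr (- 3/2)" 0])
     (use norm_log_remainder_term_le[of s] in \<open>auto intro!: summable_mult summable_Suc_powr simp del: of_nat_Suc\<close>)

lemma norm_log_remainder_le:
  "Re s \<ge> 3/4 \<Longrightarrow> norm (log_remainder g s) \<le> (\<Sum>n. 4 * real (Suc n) powr (- 3/2))"
  unfolding log_remainder_def
  by (intro norm_suminf_le norm_log_remainder_term_le summable_mult summable_Suc_powr) auto

lemma log_remainder_holomorphic: "log_remainder g holomorphic_on {s. Re s > 3/4}"
  unfolding log_remainder_def
proof (rule holomorphic_suminf)
  show "open {s. Re s > 3/4}" by (rule open_halfspace_Re_gt)
next
  fix n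
  have "1 - of_real (g (Suc n)) * of_nat (Suc n) powr (- s) \<notin> \<real>\<^sub>\<le>\<^sub>0" if "Re s > 3/4" for s
  proof
    assume "1 - of_real (g (Suc n)) * of_nat (Suc n) powr (- s) \<in> \<real>\<^sub>\<le>\<^sub>0"
    then have "Re (of_real (g (Suc n)) * of_nat (Suc n) powr (- s)) \<ge> 1"
      by (auto simp: complex_nonpos_Reals_iff)
    then show False
      using complex_Re_le_cmod[of "of_real (g (Suc n)) * of_nat (Suc n) powr (- s)"]
        norm_euler_factor_le(2)[of s n] that by linarith
  qed
  then show "(\<lambda>s. - Ln (1 - of_real (g (Suc n)) * of_nat (Suc n) powr (- s))
                - of_real (g (Suc n)) * of_nat (Suc n) powr (- s)) holomorphic_on {s. Re s > 3/4}"
    by (intro holomorphic_intros) auto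
next
  fix z :: complex assume "z \<in> {s. Re s > 3/4}"
  show "\<exists>d>0. \<exists>M. summable M \<and> (\<forall>n. \<forall>s\<in>ball z d \<inter> {s. 3/4 < Re s}.
     cmod (- Ln (1 - of_real (g (Suc n)) * of_nat (Suc n) powr (- s))
                - of_real (g (Suc n)) * of_nat (Suc n) powr (- s)) \<le> M n)"
    using norm_log_remainder_term_le
    by (intro exI[of _ 1] conjI exI[of _ "\<lambda>n. 4 * real (Suc n) powr (- 3/2)"] summable_mult summable_Suc_powr) auto
qed

end

lemma completely_multiplicative_powr:
  assumes "completely_multiplicative f" "m > 0" "n > 0"
  shows "complex_of_real (f (m * n)) * of_nat (m * n) powr (- s) =
           (of_real (f m) * of_nat m powr (- s)) * (of_real (f n) * of_nat n powr (- s))"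
proof -
  have "f (m * n) = f m * f n"
    using assms unfolding completely_multiplicative_def by blast
  moreover have "of_nat (m * n) powr (- s) = of_nat m powr (- s) * (of_nat n powr (- s) :: complex)"
    using powr_times_real[of "of_nat m" "of_nat n" "- s"] by simp
  ultimately show ?thesis by simp
qed

text \<open>Exponentiating the summed logarithms of the Euler factors returns the finite product
  whatever the branches. Its limit is therefore \<open>exp (- (P + H))\<close>, while the product
  times the series tends to 1.\<close>

lemma dirichlet_series_eq_exp:
  assumes cm: "completely_multiplicative f" and f: "\<And>n. n \<ge> 1 \<Longrightarrow> \<bar>f n\<bar> \<le> 1" and s: "Re s > 1"
  defines "g \<equiv> (\<lambda>n. if prime n then f n else 0)"
  shows "dirichlet_series f s = exp (dirichlet_series g s + log_remainder g s)"
proof -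
  define t where "t = (\<lambda>n. complex_of_real (f n) * of_nat n powr (- s))"
  define z where "z = (\<lambda>n. complex_of_real (g (Suc n)) * of_nat (Suc n) powr (- s))"
  have g: "g 1 = 0" "\<And>n. n \<ge> 1 \<Longrightarrow> \<bar>g n\<bar> \<le> 1" using f by (auto simp: g_def)
  have nt: "norm (t n) \<le> real n powr (- Re s)" for n
  proof (cases "n = 0")
    case False
    have "norm (t n) = \<bar>f n\<bar> * real n powr (- Re s)"
      using False by (simp add: t_def norm_mult norm_of_nat_powr)
    also have "\<dots> \<le> 1 * real n powr (- Re s)" using f[of n] False by (intro mult_right_mono) auto
    finally show ?thesis by simp
  qed (simp add: t_def)
  have summ: "summable (\<lambda>n. norm (t n))"
    by (rule summable_comparison_test'[of "\<lambda>n. real n powr (- Re s)" 0])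
      (use s nt in \<open>auto simp: summable_real_powr_iff\<close>)
  have t01: "t 0 = 0" "t 1 = 1"
    using cm by (auto simp: t_def completely_multiplicative_def)
  have lim: "(\<lambda>N. (\<Prod>p | prime p \<and> p < N. 1 - t p) * (\<Sum>n. t n)) \<longlonglongrightarrow> 1"
    using completely_multiplicative_powr[OF cm] t01 summ
    by (intro euler_product_tendsto) (auto simp: t_def)
  have "(\<Sum>n. t n) = (\<Sum>n. t (Suc n))"
    using suminf_split_head[OF summable_norm_cancel[OF summ]] t01 by simp
  then have F: "(\<Sum>n. t n) = dirichlet_series f s"
    by (simp add: t_def dirichlet_series_def)
  have z34: "norm (z n) \<le> 3/4" for n
    using norm_euler_factor_le(2)[of g s n] g s by (auto simp: z_def)
  have "summable z"
    by (rule summable_comparison_test'[of "\<lambda>n. real (Suc n) powr (- Re s)" 0])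
      (use s g mult_right_mono[OF g(2), of "Suc n" "real (Suc n) powr (- Re s)" for n]
        in \<open>auto intro!: summable_Suc_powr simp: z_def norm_mult norm_of_nat_powr simp del: of_nat_Suc\<close>)
  moreover have "summable (\<lambda>n. - Ln (1 - z n) - z n)"
    using summable_log_remainder[of g s] g s by (simp add: z_def)
  ultimately have "(\<lambda>N. \<Sum>n<N. z n + (- Ln (1 - z n) - z n)) \<longlonglongrightarrow> suminf z + (\<Sum>n. - Ln (1 - z n) - z n)"
    by (intro summable_LIMSEQ[THEN tendsto_eq_rhs] summable_add suminf_add[symmetric])
  then have "(\<lambda>N. \<Sum>n<N. - Ln (1 - z n)) \<longlonglongrightarrow> dirichlet_series g s + log_remainder g s"
    by (simp add: z_def dirichlet_series_def log_remainder_def)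
  then have "(\<lambda>N. exp (- (\<Sum>n<N. - Ln (1 - z n)))) \<longlonglongrightarrow> exp (- (dirichlet_series g s + log_remainder g s))"
    by (intro tendsto_exp tendsto_minus)
  moreover have "exp (- (\<Sum>n<N. - Ln (1 - z n))) = (\<Prod>p | prime p \<and> p < Suc N. 1 - t p)" for N
  proof -
    have "1 - z n \<noteq> 0" for n using z34[of n] by auto
    then have "exp (- (\<Sum>n<N. - Ln (1 - z n))) = (\<Prod>n<N. 1 - z n)"
      by (simp add: sum_negf exp_sum)
    \<comment> \<open>The index \<open>n\<close> stands for the integer \<open>Suc n\<close>, so
      \<open>N\<close> factors reach up to \<open>N\<close>, that is, over the primes below
      \<open>Suc N\<close>; nonprimes contribute 1. This shift is why \<open>LIMSEQ_Suc\<close>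
      appears below.\<close>
    also have "\<dots> = (\<Prod>p\<in>{1..N}. 1 - complex_of_real (g p) * of_nat p powr (- s))"
      by (rule prod.reindex_bij_witness[of _ "\<lambda>p. p - 1" Suc]) (auto simp: z_def)
    also have "\<dots> = (\<Prod>p | prime p \<and> p < Suc N. 1 - t p)"
      by (rule prod.mono_neutral_cong_right)
         (auto simp: g_def t_def less_Suc_eq_le prime_ge_1_nat dest: prime_ge_1_nat)
    finally show ?thesis .
  qed
  ultimately have "(\<lambda>N. \<Prod>p | prime p \<and> p < Suc N. 1 - t p)
       \<longlonglongrightarrow> exp (- (dirichlet_series g s + log_remainder g s))"
    by simp
  then have "(\<lambda>N. (\<Prod>p | prime p \<and> p < Suc N. 1 - t p) * dirichlet_series f s)
       \<longlonglongrightarrow> exp (- (dirichlet_series g s + log_remainder g s)) * dirichlet_series f s"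
    by (intro tendsto_mult_right)
  moreover have "(\<lambda>N. (\<Prod>p | prime p \<and> p < Suc N. 1 - t p) * dirichlet_series f s) \<longlonglongrightarrow> 1"
    using LIMSEQ_Suc[OF lim] F by simp
  ultimately have "exp (- (dirichlet_series g s + log_remainder g s)) * dirichlet_series f s = 1"
    by (rule LIMSEQ_unique)
  then have "exp (- (dirichlet_series g s + log_remainder g s)) * dirichlet_series f s
      = exp (- (dirichlet_series g s + log_remainder g s)) * exp (dirichlet_series g s + log_remainder g s)"
    by (simp add: exp_add[symmetric])
  then show ?thesis by (simp only: mult_cancel_left exp_not_eq_zero simp_thms) 
qed

section \<open>Landau's theorem\<close>

text \<open>The difference of the expansions represents the zero function, and a nonzero coefficient
  of positive index would make its zero at \<open>\<xi>\<close> isolated. The constant coefficient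
  is read off at \<open>\<xi>\<close> instead.\<close>

lemma power_series_unique:
  fixes a b :: "nat \<Rightarrow> complex"
  assumes "r > 0" and a: "\<And>z. norm (z - \<xi>) < r \<Longrightarrow> (\<lambda>n. a n * (z - \<xi>) ^ n) sums f z"
    and b: "\<And>z. norm (z - \<xi>) < r \<Longrightarrow> (\<lambda>n. b n * (z - \<xi>) ^ n) sums f z"
  shows "a = b"
proof -
  have d: "(\<lambda>n. (a n - b n) * (z - \<xi>) ^ n) sums 0" if "norm (z - \<xi>) < r" for z
    using sums_diff[OF a[OF that] b[OF that]] by (simp add: ring_distribs)
  have "a m = b m" for m
  proof (rule ccontr)
    assume m: "a m \<noteq> b m"
    show False
    proof (cases "m = 0")
      case True
      have "(\<lambda>n. (a n - b n) * 0 ^ n) sums 0" using d[of \<xi>] \<open>r > 0\<close> by simp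
      then show False using m True by (simp add: powser_sums_zero_iff)
    next
      case False
      obtain s where s: "0 < s" "\<And>z. z \<in> cball \<xi> s - {\<xi>} \<Longrightarrow> (\<lambda>_. 0 :: complex) z \<noteq> 0"
        by (rule powser_0_nonzero[where r = r and a = "\<lambda>n. a n - b n" and \<xi> = \<xi> and f = "\<lambda>_. 0" and m = m])
           (use d m False \<open>r > 0\<close> in auto)
      have "\<xi> + of_real s \<in> cball \<xi> s - {\<xi>}" using s by (auto simp: dist_norm)
      then show False using s(2) by blast
    qed
  qed
  then show ?thesis by blast
qed

lemma sums_infsum:
  fixes f :: "nat \<Rightarrow> 'a::banach"
  shows "f summable_on UNIV \<Longrightarrow> f sums infsum f UNIV"
  by (simp add: has_sum_imp_sums has_sum_infsum)

text \<open>Absolute summability over all pairs makes the double sum unconditional, where the order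
  may be exchanged.\<close>

lemma sums_swap:
  fixes f :: "nat \<Rightarrow> nat \<Rightarrow> complex"
  assumes 1: "\<And>n. summable (\<lambda>k. norm (f n k))" and 2: "summable (\<lambda>n. \<Sum>k. norm (f n k))"
  shows "\<And>k. summable (\<lambda>n. f n k)" "(\<lambda>k. \<Sum>n. f n k) sums (\<Sum>n. \<Sum>k. f n k)"
proof -
  have abs1: "(\<lambda>k. norm (f n k)) summable_on UNIV" for n
    using 1[of n] by (subst summable_on_UNIV_nonneg_real_iff) auto
  have eq: "infsum (\<lambda>k. norm (f n k)) UNIV = (\<Sum>k. norm (f n k))" for n
    using sums_infsum[OF abs1] by (simp add: sums_iff)
  have "(\<lambda>n. \<Sum>k. norm (f n k)) summable_on UNIV"
    using 1 2 by (subst summable_on_UNIV_nonneg_real_iff) (auto intro!: suminf_nonneg)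
  then have abs: "(\<lambda>x. norm ((\<lambda>(n,k). f n k) x)) summable_on UNIV \<times> UNIV"
    using 1 abs1 by (intro iffD2[OF Infinite_Sum.abs_summable_on_Sigma_iff]) (auto simp: eq suminf_nonneg)
  then have sm: "(\<lambda>(n,k). f n k) summable_on UNIV \<times> UNIV"
    by (rule abs_summable_summable)
  then have sw: "(\<lambda>(k,n). f n k) summable_on UNIV \<times> UNIV"
    by (subst summable_on_swap) (simp add: case_prod_unfold)
  have row: "(\<lambda>k. f n k) summable_on UNIV" for n
    using abs1 abs_summable_summable by blast
  have col: "(\<lambda>n. f n k) summable_on UNIV" for k
    using summable_on_SigmaD1[OF sw, of k] by simp
  show "summable (\<lambda>n. f n k)" for k
    using col by (rule summable_on_imp_summable)
  have "(\<lambda>k. infsum (\<lambda>n. f n k) UNIV) summable_on UNIV"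
    using summable_on_Sigma_banach[OF sw] by simp
  then have "(\<lambda>k. infsum (\<lambda>n. f n k) UNIV) sums infsum (\<lambda>k. infsum (\<lambda>n. f n k) UNIV) UNIV"
    by (rule sums_infsum)
  also have "infsum (\<lambda>k. infsum (\<lambda>n. f n k) UNIV) UNIV = infsum (\<lambda>n. infsum (\<lambda>k. f n k) UNIV) UNIV"
    by (rule infsum_swap_banach[symmetric, OF sm])
  also have "infsum (\<lambda>n. infsum (\<lambda>k. f n k) UNIV) UNIV = (\<Sum>n. infsum (\<lambda>k. f n k) UNIV)"
    using sums_infsum[of "\<lambda>n. infsum (\<lambda>k. f n k) UNIV"] summable_on_Sigma_banach[OF sm]
    by (simp add: sums_iff)
  also have "(\<lambda>n. infsum (\<lambda>k. f n k) UNIV) = (\<lambda>n. \<Sum>k. f n k)"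
    using sums_infsum[OF row] by (simp add: sums_iff)
  also have "(\<lambda>k. infsum (\<lambda>n. f n k) UNIV) = (\<lambda>k. \<Sum>n. f n k)"
    using sums_infsum[OF col] by (simp add: sums_iff)
  finally show "(\<lambda>k. \<Sum>n. f n k) sums (\<Sum>n. \<Sum>k. f n k)" .
qed

text \<open>Landau's theorem in local form. Up to the sign \<open>(-1)\<^sup>k\<close> the Taylor coefficients at \<open>b\<close>
  are sums of nonnegative terms, so the Taylor series at \<open>b - h\<close> may be summed in the other order.\<close>

lemma landau_dirichlet_series:
  fixes a :: "nat \<Rightarrow> real" and b c r h :: real
  assumes a: "\<And>n. n \<ge> 1 \<Longrightarrow> a n \<ge> 0" and "c < b"
    and conv: "\<And>x. x > c \<Longrightarrow> summable (\<lambda>n. a (Suc n) * real (Suc n) powr (- x))"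
    and G: "G holomorphic_on ball (of_real b) r"
    and eq: "\<And>s. s \<in> ball (of_real b) r \<Longrightarrow> Re s > c \<Longrightarrow> G s = dirichlet_series a s"
    and h: "0 \<le> h" "h < r"
  shows "summable (\<lambda>n. a (Suc n) * real (Suc n) powr (- (b - h)))"
proof -
  define u where "u = (\<lambda>n. a (Suc n) * real (Suc n) powr (- b))"
  define L where "L = (\<lambda>n. ln (real (Suc n)))"
  \<comment> \<open>Each derivative of \<open>n powr (-s)\<close> brings down \<open>- ln n\<close>,
    so \<open>C k\<close> is \<open>(-1)^k\<close> times the \<open>k\<close>-th Taylor coefficient
    at \<open>b\<close>.\<close>
  define C where "C = (\<lambda>k. \<Sum>n. u n * L n ^ k / fact k)"
  have u: "u n \<ge> 0" and L: "L n \<ge> 0" for n using a by (auto simp: u_def L_def)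
  have inner: "(\<lambda>k. u n * (x * L n) ^ k / fact k) sums (a (Suc n) * real (Suc n) powr (- (b - x)))" for n x
  proof -
    have "(\<lambda>k. u n * ((x * L n) ^ k /\<^sub>R fact k)) sums (u n * exp (x * L n))"
      by (intro sums_mult exp_converges)
    moreover have "u n * exp (x * L n) = a (Suc n) * (real (Suc n) powr (- b) * real (Suc n) powr x)"
      by (simp add: u_def L_def powr_def)
    moreover have "\<dots> = a (Suc n) * real (Suc n) powr (- (b - x))"
      by (simp only: powr_add[symmetric]) (simp add: algebra_simps)
    moreover have "(\<lambda>k. u n * ((x * L n) ^ k /\<^sub>R fact k)) = (\<lambda>k. u n * (x * L n) ^ k / fact k)"
      by (simp add: divide_inverse mult_ac)
    ultimately show ?thesis by (simp only:)
  qed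
  \<comment> \<open>Expanding the power with exponent \<open>w\<close> gives an absolutely
    convergent double series: its norms add up to the Dirichlet series at
    \<open>b - norm w > c\<close>.\<close>
  have series: "summable (\<lambda>n. u n * L n ^ k / fact k)"
    "(\<lambda>k. of_real (C k) * w ^ k) sums dirichlet_series a (of_real b - w)" if w: "norm w < b - c" for w :: complex and k
  proof -
    define f where "f = (\<lambda>n k. complex_of_real (u n) * (w * of_real (L n)) ^ k / fact k)"
    have nf: "norm (f n k) = u n * (norm w * L n) ^ k / fact k" for n k
      using u[of n] L[of n] by (simp add: f_def norm_mult norm_divide norm_power)
    have 1: "summable (\<lambda>k. norm (f n k))" for n
      unfolding nf using inner sums_summable by blast
    have "(\<Sum>k. norm (f n k)) = a (Suc n) * real (Suc n) powr (- (b - norm w))" for n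
      unfolding nf using inner[of n "norm w"] by (simp add: sums_iff)
    then have 2: "summable (\<lambda>n. \<Sum>k. norm (f n k))"
      using conv[of "b - norm w"] w by simp
    have fs: "(\<lambda>k. f n k) sums (of_real (a (Suc n)) * of_nat (Suc n) powr (- (of_real b - w)))" for n
    proof -
      have "(\<lambda>k. complex_of_real (u n) * ((w * of_real (L n)) ^ k /\<^sub>R fact k)) sums (of_real (u n) * exp (w * of_real (L n)))"
        by (intro sums_mult exp_converges)
      moreover have "of_real (u n) * exp (w * of_real (L n))
           = of_real (a (Suc n)) * (of_nat (Suc n) powr (- of_real b) * of_nat (Suc n) powr w)"
      proof -
        have "complex_of_real (real (Suc n) powr (- b)) = of_nat (Suc n) powr (- of_real b)"
          by (subst powr_of_real[symmetric]) auto
        moreover have "exp (w * of_real (L n)) = of_nat (Suc n) powr w"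
          by (simp add: L_def powr_def Ln_of_nat del: of_nat_Suc)
        ultimately show ?thesis by (simp add: u_def del: of_nat_Suc)
      qed
      moreover have "\<dots> = of_real (a (Suc n)) * of_nat (Suc n) powr (- (of_real b - w))"
        by (simp only: powr_add[symmetric]) (simp add: algebra_simps)
      moreover have "(\<lambda>k. complex_of_real (u n) * ((w * of_real (L n)) ^ k /\<^sub>R fact k)) = f n"
        by (simp add: f_def scaleR_conv_of_real divide_inverse mult_ac)
      ultimately show ?thesis by (simp only:)
    qed
    have "(\<Sum>n. \<Sum>k. f n k) = dirichlet_series a (of_real b - w)"
      unfolding dirichlet_series_def using fs by (simp add: sums_iff)
    moreover have C: "f n k = of_real (u n * L n ^ k / fact k) * w ^ k" for n k
      by (simp add: f_def power_mult_distrib)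
    ultimately have *: "\<And>k. summable (\<lambda>n. of_real (u n * L n ^ k / fact k) * w ^ k)"
      "(\<lambda>k. \<Sum>n. of_real (u n * L n ^ k / fact k) * w ^ k) sums dirichlet_series a (of_real b - w)"
      using sums_swap[OF 1 2] by simp_all
    have coeff: "summable (\<lambda>n. u n * L n ^ k / fact k)" for k
    proof -
      \<comment> \<open>A single term of a nonnegative exponential series is at most its sum. Any
        \<open>x\<close> strictly between 0 and \<open>b - c\<close> keeps this sum in the region of
        convergence and permits division by \<open>x ^ k\<close>.\<close>
      define x where "x = (b - c) / 2"
      have x: "x > 0" "x < b - c" using \<open>c < b\<close> by (auto simp: x_def)
      have "u n * L n ^ k / fact k \<le> (1 / x ^ k) * (a (Suc n) * real (Suc n) powr (- (b - x)))" for n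
      proof -
        have "u n * (x * L n) ^ k / fact k \<le> a (Suc n) * real (Suc n) powr (- (b - x))"
          using inner[of n x] u L x sum_le_suminf[of "\<lambda>k. u n * (x * L n) ^ k / fact k" "{k}"]
          by (simp add: sums_iff)
        then show ?thesis using x by (simp add: power_mult_distrib field_simps)
      qed
      then show ?thesis
        using u L x
        by (intro summable_comparison_test'[OF summable_mult[OF conv[of "b - x"], of "1 / x ^ k"], of 0]) auto
    qed
    show "summable (\<lambda>n. u n * L n ^ k / fact k)" by (rule coeff)
    have "(\<Sum>n. of_real (u n * L n ^ k / fact k) * w ^ k) = of_real (C k) * w ^ k" for k
      using suminf_mult2[OF summable_of_real[OF coeff[of k], where 'a = complex], of "w ^ k"]
        suminf_of_real[OF coeff[of k], where 'a = complex]
      by (simp add: C_def)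
    then show "(\<lambda>k. of_real (C k) * w ^ k) sums dirichlet_series a (of_real b - w)"
      using *(2) by simp
  qed
  have r: "r > 0" using h by simp
  \<comment> \<open>Both expansions hold on the smaller disc. Once the coefficients agree there, the
    Taylor series of \<open>G\<close>, valid on the whole ball of radius \<open>r\<close>, may be
    written with the \<open>C k\<close>.\<close>
  have "(\<lambda>k. of_real (C k) * (-1) ^ k) = (\<lambda>k. (deriv ^^ k) G (of_real b) / fact k)"
  proof (rule power_series_unique[of "min r (b - c)" "of_real b" _ G])
    fix z :: complex assume z: "norm (z - of_real b) < min r (b - c)"
    have zb: "z \<in> ball (of_real b) r" using z by (simp add: dist_norm norm_minus_commute)
    show "(\<lambda>k. (deriv ^^ k) G (of_real b) / fact k * (z - of_real b) ^ k) sums G z"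
      by (rule holomorphic_power_series[OF G zb])
    have "b - Re z \<le> norm (z - of_real b)"
      using abs_Re_le_cmod[of "z - of_real b"] by simp
    then have "Re z > c" using z by simp
    then have "G z = dirichlet_series a z" by (rule eq[OF zb])
    then show "(\<lambda>k. of_real (C k) * (-1) ^ k * (z - of_real b) ^ k) sums G z"
      using series(2)[of "of_real b - z"] z
      by (simp add: norm_minus_commute mult.assoc flip: power_mult_distrib)
  qed (use r \<open>c < b\<close> in auto)
  then have coeff: "(deriv ^^ k) G (of_real b) / fact k = of_real (C k) * (-1) ^ k" for k
    by metis
  \<comment> \<open>At \<open>b - h\<close> the signs in \<open>(-1)^k\<close> and
    \<open>(-h)^k\<close> cancel, leaving the nonnegative terms \<open>C k * h ^ k\<close>.\<close>
  have "(\<lambda>k. (deriv ^^ k) G (of_real b) / fact k * (of_real (b - h) - of_real b) ^ k) sums G (of_real (b - h))"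
    using h by (intro holomorphic_power_series[OF G]) (auto simp: dist_norm)
  then have "summable (\<lambda>k. complex_of_real (C k * h ^ k))"
    by (simp add: coeff mult.assoc sums_iff flip: power_mult_distrib)
  then have Ch: "summable (\<lambda>k. C k * h ^ k)"
    by (simp only: summable_of_real_iff)
  show ?thesis
  \<comment> \<open>With nonnegative terms bounded partial sums suffice, so only a finite sum over
    \<open>n\<close> is exchanged with the series over \<open>k\<close>.\<close>
  proof (rule bounded_imp_summable)
    show "a (Suc n) * real (Suc n) powr (- (b - h)) \<ge> 0" for n using a by simp
    fix N
    have "(\<Sum>n\<le>N. a (Suc n) * real (Suc n) powr (- (b - h))) = (\<Sum>n\<le>N. \<Sum>k. u n * (h * L n) ^ k / fact k)"
      using inner[of _ h] by (simp add: sums_iff)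
    also have "\<dots> = (\<Sum>k. \<Sum>n\<le>N. u n * (h * L n) ^ k / fact k)"
      using inner[of _ h] by (intro suminf_sum[symmetric]) (auto simp: sums_iff)
    also have "\<dots> \<le> (\<Sum>k. C k * h ^ k)"
    proof (rule suminf_le)
      show "summable (\<lambda>k. \<Sum>n\<le>N. u n * (h * L n) ^ k / fact k)"
        using inner[of _ h] by (intro summable_sum) (auto simp: sums_iff)
      fix k
      have "(\<Sum>n\<le>N. u n * L n ^ k / fact k) \<le> C k"
        unfolding C_def using u L series(1)[of 0 k] \<open>c < b\<close> by (intro sum_le_suminf) auto
      then have "(\<Sum>n\<le>N. u n * L n ^ k / fact k) * h ^ k \<le> C k * h ^ k"
        using h by (intro mult_right_mono) auto
      then show "(\<Sum>n\<le>N. u n * (h * L n) ^ k / fact k) \<le> C k * h ^ k"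
        by (simp add: power_mult_distrib sum_distrib_left sum_distrib_right mult_ac)
    qed (rule Ch)
    finally show "(\<Sum>n\<le>N. a (Suc n) * real (Suc n) powr (- (b - h))) \<le> (\<Sum>k. C k * h ^ k)" .
  qed
qed

section \<open>Linear growth of a logarithm\<close>

text \<open>\<open>Re g < M\<close> makes \<open>g\<close> closer to 0 than to \<open>2 * M\<close>,
  so \<open>g / (2 * M - g)\<close> maps the disc into the unit disc and vanishes at the centre. The
  Schwarz lemma bounds it by \<open>r / R\<close>; solving for \<open>g\<close> gives the
  claim.\<close>

lemma borel_caratheodory:
  fixes g :: "complex \<Rightarrow> complex"
  assumes g: "g holomorphic_on ball z0 R" and g0: "g z0 = 0" and M: "M > 0"
    and Re_le: "\<And>z. z \<in> ball z0 R \<Longrightarrow> Re (g z) < M"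
    and z: "norm (z - z0) \<le> r" "r < R"
  shows "norm (g z) \<le> 2 * M * r / (R - r)"
proof -
  have R: "R > 0" "r \<ge> 0" using z norm_ge_zero[of "z - z0"] by linarith+
  define G where "G = (\<lambda>\<zeta>. g (z0 + of_real R * \<zeta>))"
  define \<phi> where "\<phi> = (\<lambda>\<zeta>. G \<zeta> / (of_real (2 * M) - G \<zeta>))"
  have in_ball: "z0 + of_real R * \<zeta> \<in> ball z0 R" if "norm \<zeta> < 1" for \<zeta>
    using that R by (simp add: dist_norm norm_mult)
  have G: "G holomorphic_on ball 0 1"
    unfolding G_def
    by (rule holomorphic_on_compose_gen[OF _ g, unfolded o_def])
       (use in_ball in \<open>auto intro!: holomorphic_intros\<close>)
  have Re_G: "Re (G \<zeta>) < M" if "norm \<zeta> < 1" for \<zeta>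
    using Re_le[OF in_ball[OF that]] by (simp add: G_def)
  have nz: "of_real (2 * M) - G \<zeta> \<noteq> 0" if "norm \<zeta> < 1" for \<zeta>
  proof
    assume "of_real (2 * M) - G \<zeta> = 0"
    then have "Re (G \<zeta>) = 2 * M" by (simp add: complex_eq_iff)
    then show False using Re_G[OF that] M by simp
  qed
  have "norm (\<phi> \<zeta>) \<le> norm \<zeta>" if "norm \<zeta> < 1" for \<zeta>
  proof (rule Schwarz_Lemma(1))
    show "\<phi> holomorphic_on ball 0 1"
      unfolding \<phi>_def using nz by (intro holomorphic_intros G) auto
    show "\<phi> 0 = 0" by (simp add: \<phi>_def G_def g0)
    show "norm (\<phi> w) < 1" if "norm w < 1" for w
    proof -
      have "(norm (G w))\<^sup>2 < (norm (of_real (2 * M) - G w))\<^sup>2"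
      proof -
        have "(norm (of_real (2 * M) - G w))\<^sup>2 = (norm (G w))\<^sup>2 + 4 * M * (M - Re (G w))"
          unfolding cmod_power2 by (simp add: power2_eq_square algebra_simps)
        moreover have "4 * M * (M - Re (G w)) > 0" using M Re_G[OF that] by simp
        ultimately show ?thesis by linarith
      qed
      then have "norm (G w) < norm (of_real (2 * M) - G w)"
        by (rule power_less_imp_less_base) simp
      then show ?thesis
        using nz[OF that] by (simp add: \<phi>_def norm_divide divide_less_eq)
    qed
  qed (rule that)
  moreover define \<zeta> where "\<zeta> = (z - z0) / of_real R"
  have \<zeta>: "norm \<zeta> \<le> r / R" using z R by (simp add: \<zeta>_def norm_divide divide_right_mono)
  moreover have rR: "r / R < 1" using z R by simp
  ultimately have \<phi>: "norm (\<phi> \<zeta>) \<le> r / R" by (meson le_less_trans order_trans)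
  have g_eq: "G \<zeta> = g z" using R by (simp add: G_def \<zeta>_def)
  have "G \<zeta> = \<phi> \<zeta> * (of_real (2 * M) - G \<zeta>)"
    using nz[of \<zeta>] \<zeta> rR by (simp add: \<phi>_def)
  then have "norm (g z) = norm (\<phi> \<zeta>) * norm (of_real (2 * M) - g z)"
    by (metis g_eq norm_mult)
  also have "\<dots> \<le> r / R * (2 * M + norm (g z))"
    using \<phi> M R norm_triangle_ineq4[of "of_real (2 * M)" "g z"] by (intro mult_mono) auto
  finally have "norm (g z) * (R - r) \<le> 2 * M * r"
    using R by (simp add: field_simps)
  then show ?thesis using z by (simp add: pos_le_divide_eq)
qed

text \<open>Borel-Caratheodory on discs centred on \<open>Re s = 2\<close>, where \<open>L\<close>
  is bounded. The radius \<open>1 + \<eta>\<close> reaches the line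
  \<open>Re s = 1 - \<eta>\<close>, the inner radius \<open>1 + \<eta> / 2\<close> reaches
  \<open>1 - \<eta> / 2\<close>, and their difference is the denominator
  \<open>\<eta> / 2\<close>.\<close>

lemma log_linear_growth:
  assumes L: "L holomorphic_on {s. Re s > 1 - \<epsilon>}" and \<eta>: "0 < \<eta>" "\<eta> < \<epsilon>" "\<eta> \<le> 1"
    and F: "\<And>s. Re s \<ge> 1 - \<eta> \<Longrightarrow> norm (exp (L s)) \<le> C * norm s"
    and B: "\<And>s. Re s = 2 \<Longrightarrow> norm (L s) \<le> B"
  obtains C' where "C' \<ge> 0" "\<And>s. 1 - \<eta> / 2 \<le> Re s \<Longrightarrow> Re s \<le> 2 \<Longrightarrow> norm (L s) \<le> C' * (1 + norm s)"
proof -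
  have C: "C \<ge> 0"
    using order_trans[OF norm_ge_zero F[of 1]] \<eta> by simp
  have B0: "B \<ge> 0" using order_trans[OF norm_ge_zero B[of 2]] by simp
  define r where "r = 1 + \<eta> / 2"
  define C' where "C' = B + 2 * (4 * C + B + 1) * r / (\<eta> / 2)"
  have r: "r > 0" using \<eta> by (simp add: r_def)
  have "norm (L s) \<le> C' * (1 + norm s)" if s: "1 - \<eta> / 2 \<le> Re s" "Re s \<le> 2" for s
  proof -
    define s0 where "s0 = Complex 2 (Im s)"
    \<comment> \<open>Points of the disc have norm at most \<open>4 * (1 + norm s)\<close>, whence
      \<open>4 * C\<close>; \<open>B\<close> pays for subtracting \<open>L s0\<close>, and the 1
      keeps \<open>M\<close> positive when \<open>C\<close> and \<open>B\<close> vanish.\<close>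
    define M where "M = (4 * C + B + 1) * (1 + norm s)"
    have ns0: "norm s0 \<le> 2 + norm s"
      using cmod_le[of s0] abs_Im_le_cmod[of s] by (simp add: s0_def)
    have ball: "Re z \<ge> 1 - \<eta> \<and> norm z \<le> 4 * (1 + norm s)" if z: "z \<in> ball s0 (1 + \<eta>)" for z
    proof -
      have "norm (z - s0) < 1 + \<eta>" using z by (simp add: dist_norm norm_minus_commute)
      moreover have "2 - Re z \<le> norm (z - s0)"
        using abs_Re_le_cmod[of "z - s0"] by (simp add: s0_def)
      moreover have "norm z \<le> norm s0 + norm (z - s0)" using norm_triangle_ineq[of s0 "z - s0"] by simp
      ultimately show ?thesis using ns0 \<eta> norm_ge_zero[of s] unfolding ring_distribs by linarith
    qed
    have g: "norm (L s - L s0) \<le> 2 * M * r / ((1 + \<eta>) - r)"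
    proof (rule borel_caratheodory[where g = "\<lambda>z. L z - L s0" and ?z0.0 = s0])
      show "(\<lambda>z. L z - L s0) holomorphic_on ball s0 (1 + \<eta>)"
        using ball \<eta> by (intro holomorphic_intros holomorphic_on_subset[OF L]) force
      have "4 * C + B + 1 > 0" "1 + norm s > 0" using C B0 norm_ge_zero[of s] by linarith+
      then show "M > 0" by (simp add: M_def)
      show "norm (s - s0) \<le> r"
      proof -
        have "s - s0 = of_real (Re s - 2)" by (simp add: s0_def complex_eq_iff)
        then show ?thesis using s by (simp add: r_def del: of_real_diff)
      qed
      fix z assume z: "z \<in> ball s0 (1 + \<eta>)"
      have "exp (Re (L z)) \<le> C * norm z" using F[of z] ball[OF z] by (simp add: norm_exp_eq_Re)
      \<comment> \<open>\<open>exp x \<ge> 1 + x\<close> gives a linear bound in place of a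
        logarithmic one, which suffices, and supplies the strict inequality.\<close>
      then have "Re (L z) < C * norm z" using exp_ge_add_one_self[of "Re (L z)"] by linarith
      also have "\<dots> \<le> C * (4 * (1 + norm s))" using ball[OF z] C by (intro mult_left_mono) auto
      finally have "Re (L z) < 4 * C * (1 + norm s)" by (simp only: mult_ac)
      moreover have "- Re (L s0) \<le> B" using abs_Re_le_cmod[of "L s0"] B[of s0] by (simp add: s0_def)
      moreover have "B * 1 \<le> B * (1 + norm s)" using B0 by (intro mult_left_mono) auto
      ultimately show "Re (L z - L s0) < M"
        using norm_ge_zero[of s] unfolding M_def ring_distribs minus_complex.simps by linarith
    qed (use \<eta> in \<open>auto simp: r_def\<close>)
    have "norm (L s) \<le> norm (L s0) + norm (L s - L s0)" using norm_triangle_ineq[of "L s0" "L s - L s0"] by simp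
    also have "\<dots> \<le> B * (1 + norm s) + 2 * M * r / (\<eta> / 2)"
    proof (intro add_mono)
      have "norm (L s0) \<le> B * 1" using B[of s0] by (simp add: s0_def)
      also have "\<dots> \<le> B * (1 + norm s)" using B0 by (intro mult_left_mono) auto
      finally show "norm (L s0) \<le> B * (1 + norm s)" .
      show "norm (L s - L s0) \<le> 2 * M * r / (\<eta> / 2)" using g by (simp add: r_def)
    qed
    also have "\<dots> = C' * (1 + norm s)" by (simp add: C'_def M_def algebra_simps add_divide_distrib)
    finally show ?thesis .
  qed
  moreover have "C' \<ge> 0" using C B0 r \<eta> by (simp add: C'_def)
  ultimately show ?thesis using that by blast
qed

section \<open>Newman's contour argument\<close>

text \<open>A simple pole at 0 with residue 1, so that a closed contour reads off
  \<open>f 0\<close>. With \<open>T = ln N\<close> the exponential is \<open>N^z\<close>; on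
  \<open>norm z = R\<close> the bracket equals \<open>2 * Re z / R^2\<close>.\<close>

definition newman_kernel :: "real \<Rightarrow> real \<Rightarrow> complex \<Rightarrow> complex" where
  "newman_kernel T R z = exp (of_real T * z) * (1 / z + z / (of_real R)\<^sup>2)"

text \<open>Residue theorem without winding numbers: the pole is split off as
  \<open>f 0 / z\<close>, and \<open>1 / z\<close> is integrated by the primitive
  \<open>Ln z\<close> on the right and \<open>Ln (- z)\<close> on the left, each contributing
  \<open>pi * \<i>\<close>. The left path is left open so that both a half circle and a rectangle
  fit.\<close>

lemma contour_integral_newman_kernel:
  assumes f: "f holomorphic_on S" and S: "open S" "convex S" "0 \<in> S" and R: "R > 0"
    and \<gamma>: "valid_path \<gamma>" "pathstart \<gamma> = \<i> * of_real R" "pathfinish \<gamma> = - \<i> * of_real R"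
      "path_image \<gamma> \<subseteq> S" "path_image \<gamma> \<subseteq> {z. Re z \<le> 0} - {0}"
    and arc: "path_image (part_circlepath 0 R (- pi / 2) (pi / 2)) \<subseteq> S"
  shows "(\<lambda>z. f z * newman_kernel T R z) contour_integrable_on (part_circlepath 0 R (- pi / 2) (pi / 2))"
    and "(\<lambda>z. f z * newman_kernel T R z) contour_integrable_on \<gamma>"
    and "contour_integral (part_circlepath 0 R (- pi / 2) (pi / 2)) (\<lambda>z. f z * newman_kernel T R z)
           + contour_integral \<gamma> (\<lambda>z. f z * newman_kernel T R z) = 2 * pi * \<i> * f 0"
proof -
  define \<gamma>\<^sub>0 where "\<gamma>\<^sub>0 = part_circlepath 0 R (- pi / 2) (pi / 2)"
  have ends: "pathstart \<gamma>\<^sub>0 = - \<i> * of_real R" "pathfinish \<gamma>\<^sub>0 = \<i> * of_real R"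
    using cis_conv_exp[of "pi / 2"] cis_conv_exp[of "- pi / 2"] by (simp_all add: \<gamma>\<^sub>0_def)
  have vp0: "valid_path \<gamma>\<^sub>0" by (simp add: \<gamma>\<^sub>0_def)
  have arc_sub: "path_image \<gamma>\<^sub>0 \<subseteq> {z. Re z \<ge> 0} - {0}"
    using R by (auto simp: \<gamma>\<^sub>0_def path_image_part_circlepath Re_exp intro!: mult_nonneg_nonneg cos_ge_zero)
  have arcS: "path_image \<gamma>\<^sub>0 \<subseteq> S" using arc by (simp add: \<gamma>\<^sub>0_def)
  define F where "F = (\<lambda>z. f z * newman_kernel T R z)"
  define h where "h = (\<lambda>z. f z * exp (of_real T * z) * (1 + z\<^sup>2 / (of_real R)\<^sup>2))"
  \<comment> \<open>The integrand without its pole, with the removable singularity at 0 filled in;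
    its integral over the closed path is 0.\<close>
  define q where "q = (\<lambda>z. if z = 0 then deriv h 0 else (h z - h 0) / (z - 0))"
  have h: "h holomorphic_on S" unfolding h_def using R by (intro holomorphic_intros f) auto
  have q: "q holomorphic_on S" unfolding q_def by (rule pole_lemma_open[OF h S(1)])
  have F_eq: "F z = q z + f 0 * (1 / z)" if "z \<noteq> 0" for z
    using that R by (simp add: F_def h_def q_def newman_kernel_def field_simps power2_eq_square)
  have closed: "(q has_contour_integral 0) (\<gamma>\<^sub>0 +++ \<gamma>)"
    using q S(2) ends \<gamma> vp0 arcS
    by (intro Cauchy_theorem_convex_simple) (auto simp: path_image_join)
  have qi: "q contour_integrable_on \<gamma>\<^sub>0" "q contour_integrable_on \<gamma>"
    using contour_integrable_holomorphic_simple[OF q S(1)] vp0 arcS \<gamma> by auto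
  have q0: "contour_integral \<gamma>\<^sub>0 q + contour_integral \<gamma> q = 0"
    using contour_integral_unique[OF closed] qi vp0 \<gamma>(1) by simp
  have inv0: "((\<lambda>z. 1 / z) has_contour_integral (Ln (pathfinish \<gamma>\<^sub>0) - Ln (pathstart \<gamma>\<^sub>0))) \<gamma>\<^sub>0"
  proof (rule contour_integral_primitive[OF _ vp0 arc_sub])
    fix z :: complex assume "z \<in> {z. 0 \<le> Re z} - {0}"
    then have "z \<notin> \<real>\<^sub>\<le>\<^sub>0" by (auto simp: complex_nonpos_Reals_iff complex_eq_iff)
    then show "(Ln has_field_derivative 1 / z) (at z within {z. 0 \<le> Re z} - {0})"
      using has_field_derivative_at_within[OF has_field_derivative_Ln[of z]] by (simp add: divide_inverse)
  qed
  have inv: "((\<lambda>z. 1 / z) has_contour_integral (Ln (- pathfinish \<gamma>) - Ln (- pathstart \<gamma>))) \<gamma>"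
  proof (rule contour_integral_primitive[OF _ \<gamma>(1) \<gamma>(5)])
    fix z :: complex assume z: "z \<in> {z. Re z \<le> 0} - {0}"
    then have "- z \<notin> \<real>\<^sub>\<le>\<^sub>0" by (auto simp: complex_nonpos_Reals_iff complex_eq_iff)
    then have "((\<lambda>z. Ln (- z)) has_field_derivative inverse (- z) * (- 1)) (at z)"
      by (intro DERIV_chain2[OF has_field_derivative_Ln]) (auto intro!: derivative_eq_intros)
    then have "((\<lambda>z. Ln (- z)) has_field_derivative 1 / z) (at z)"
      using z by (simp add: divide_inverse)
    then show "((\<lambda>z. Ln (- z)) has_field_derivative 1 / z) (at z within {z. Re z \<le> 0} - {0})"
      by (rule has_field_derivative_at_within)
  qed
  have Ln_i: "Ln (\<i> * of_real R) - Ln (- \<i> * of_real R) = pi * \<i>"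
    using Ln_times_of_real[OF R, of \<i>] Ln_times_of_real[OF R, of "- \<i>"] by (simp add: mult.commute)
  have int0: "(F has_contour_integral (contour_integral \<gamma>\<^sub>0 q + f 0 * (pi * \<i>))) \<gamma>\<^sub>0"
  proof (rule has_contour_integral_eq)
    show "((\<lambda>z. q z + f 0 * (1 / z)) has_contour_integral (contour_integral \<gamma>\<^sub>0 q + f 0 * (pi * \<i>))) \<gamma>\<^sub>0"
      using inv0 Ln_i ends qi
      by (intro has_contour_integral_add has_contour_integral_lmul) (auto simp: has_contour_integral_integral)
  next
    show "q z + f 0 * (1 / z) = F z" if "z \<in> path_image \<gamma>\<^sub>0" for z
      using subsetD[OF arc_sub that] by (intro F_eq[symmetric]) simp
  qed
  have int1: "(F has_contour_integral (contour_integral \<gamma> q + f 0 * (pi * \<i>))) \<gamma>"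
  proof (rule has_contour_integral_eq)
    show "((\<lambda>z. q z + f 0 * (1 / z)) has_contour_integral (contour_integral \<gamma> q + f 0 * (pi * \<i>))) \<gamma>"
      using inv Ln_i \<gamma> qi
      by (intro has_contour_integral_add has_contour_integral_lmul) (auto simp: has_contour_integral_integral)
  next
    show "q z + f 0 * (1 / z) = F z" if "z \<in> path_image \<gamma>" for z
      using subsetD[OF \<gamma>(5) that] by (intro F_eq[symmetric]) simp
  qed
  show "(\<lambda>z. f z * newman_kernel T R z) contour_integrable_on (part_circlepath 0 R (- pi / 2) (pi / 2))"
    using int0 unfolding F_def \<gamma>\<^sub>0_def contour_integrable_on_def by blast
  show "(\<lambda>z. f z * newman_kernel T R z) contour_integrable_on \<gamma>"
    using int1 unfolding F_def contour_integrable_on_def by blast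
  show "contour_integral (part_circlepath 0 R (- pi / 2) (pi / 2)) (\<lambda>z. f z * newman_kernel T R z)
           + contour_integral \<gamma> (\<lambda>z. f z * newman_kernel T R z) = 2 * pi * \<i> * f 0"
    using contour_integral_unique[OF int0] contour_integral_unique[OF int1] q0
    by (simp add: F_def \<gamma>\<^sub>0_def algebra_simps add_eq_0_iff)
qed

section \<open>Power sums compared with integrals\<close>

lemma powr_diff_bounds:
  fixes x v :: real
  assumes "x > 0" 
  shows "v < 1 \<Longrightarrow> v \<noteq> 0 \<Longrightarrow> (x + 1) powr (v - 1) \<le> ((x + 1) powr v - x powr v) / v"
    and "v \<ge> 1 \<Longrightarrow> x powr (v - 1) \<le> ((x + 1) powr v - x powr v) / v"
proof -
  have "\<exists>z. x < z \<and> z < x + 1 \<and> (x + 1) powr v - x powr v = (x + 1 - x) * (v * z powr (v - 1))"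
    using assms by (intro MVT2) (auto intro!: derivative_eq_intros)
  then obtain z where z: "x < z" "z < x + 1" "(x + 1) powr v - x powr v = v * z powr (v - 1)" by auto
  show "(x + 1) powr (v - 1) \<le> ((x + 1) powr v - x powr v) / v" if "v < 1" "v \<noteq> 0"
    using z that assms by (auto intro!: powr_mono2')
  show "x powr (v - 1) \<le> ((x + 1) powr v - x powr v) / v" if "v \<ge> 1"
    using z that assms by (auto intro!: powr_mono2)
qed

text \<open>Telescoping of \<open>n powr (- x) / x\<close>. The explicit \<open>1 / x\<close>
  matters: on the circle it is cancelled by the factor \<open>Re z\<close> of the kernel.\<close>

lemma sum_powr_tail_le:
  assumes "x > 0" "N \<ge> 1"
  shows "summable (\<lambda>n. real (Suc (n + N)) powr (- 1 - x))"
    and "(\<Sum>n. real (Suc (n + N)) powr (- 1 - x)) \<le> real N powr (- x) / x"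
proof -
  have le: "real (Suc (n + N)) powr (- 1 - x) \<le> real (n + N) powr (- x) / x - real (Suc (n + N)) powr (- x) / x" for n
    using powr_diff_bounds(1)[of "real (n + N)" "- x"] assms
    by (subst minus_diff_commute) (simp add: add_ac diff_divide_distrib algebra_simps)
  have "(\<lambda>n. real (n + N) powr (- x) / x) \<longlonglongrightarrow> 0 / x"
    using assms by (intro tendsto_divide tendsto_const tendsto_neg_powr
        filterlim_compose[OF filterlim_real_sequentially filterlim_add_const_nat_at_top]) auto
  then have tele: "(\<lambda>n. real (n + N) powr (- x) / x - real (Suc n + N) powr (- x) / x) sums (real (0 + N) powr (- x) / x - 0)"
    by (intro telescope_sums') simp
  show sm: "summable (\<lambda>n. real (Suc (n + N)) powr (- 1 - x))"
    by (rule summable_comparison_test'[OF sums_summable[OF tele], of 0]) (use le in auto)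
  have "(\<Sum>n. real (Suc (n + N)) powr (- 1 - x))
      \<le> (\<Sum>n. real (n + N) powr (- x) / x - real (Suc n + N) powr (- x) / x)"
    by (rule suminf_le[OF _ sm sums_summable[OF tele]]) (use le in auto)
  also have "\<dots> = real N powr (- x) / x"
    using sums_unique[OF tele] by simp
  finally show "(\<Sum>n. real (Suc (n + N)) powr (- 1 - x)) \<le> real N powr (- x) / x" .
qed

text \<open>For \<open>u < 1\<close> the summands decrease and telescoping leaves nothing over; for
  \<open>u \<ge> 1\<close> they do not decrease and the last one is left over, which is the
  \<open>1 / N\<close>.\<close>

lemma sum_powr_head_le:
  assumes "u > 0" "N \<ge> 1"
  shows "(\<Sum>n<N. real (Suc n) powr (u - 1)) \<le> real N powr u * (1 / u + 1 / real N)"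
proof -
  have "(\<Sum>n<N. real (Suc n) powr (u - 1)) \<le> real N powr u / u + real N powr (u - 1)"
  proof (cases "u < 1")
    case True
    have "(\<Sum>n<N. real (Suc n) powr (u - 1)) \<le> real N powr u / u"
    proof (induction N)
      case (Suc N)
      have "real (Suc N) powr (u - 1) \<le> (real (Suc N) powr u - real N powr u) / u"
        using powr_diff_bounds(1)[of "real N" u] True assms by (cases "N = 0") (auto simp: add_ac)
      then show ?case using Suc by (simp add: diff_divide_distrib)
    qed auto
    then show ?thesis using powr_ge_zero[of "real N" "u - 1"] by linarith
  next
    case False
    have "(\<Sum>n<Suc N. real (Suc n) powr (u - 1)) \<le> real (Suc N) powr u / u + real (Suc N) powr (u - 1)" for N
    proof (induction N)
      case (Suc N)
      have "real (Suc N) powr (u - 1) \<le> (real (Suc (Suc N)) powr u - real (Suc N) powr u) / u"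
        using powr_diff_bounds(2)[of "real (Suc N)" u] False by (auto simp: add_ac)
      then show ?case using Suc by (simp add: diff_divide_distrib)
    qed (use assms in auto)
    from this[of "N - 1"] show ?thesis using assms(2) by simp
  qed
  also have "real N powr (u - 1) = real N powr u * (1 / real N)"
    using assms by (simp add: powr_diff)
  finally show ?thesis by (simp add: algebra_simps)
qed

section \<open>Size of the kernel on the circle and on the rectangle\<close>

lemma norm_exp_ln: "N \<ge> 1 \<Longrightarrow> norm (exp (of_real (ln (real N)) * z)) = real N powr Re z"
  by (simp add: norm_exp_eq_Re powr_def mult.commute)

lemma norm_newman_kernel_circle:
  assumes "norm z = R" "R > 0" "N \<ge> 1"
  shows "norm (newman_kernel (ln (real N)) R z) = real N powr Re z * (2 * \<bar>Re z\<bar> / R\<^sup>2)"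
proof -
  have "z \<noteq> 0" using assms by auto
  have "z * cnj z = of_real (R\<^sup>2)" using assms(1) complex_norm_square[of z] by simp
  then have "1 / z = cnj z / (of_real R)\<^sup>2"
    using \<open>z \<noteq> 0\<close> \<open>R > 0\<close> by (simp add: field_simps)
  then have "1 / z + z / (of_real R)\<^sup>2 = (cnj z + z) / (of_real R)\<^sup>2"
    by (simp add: add_divide_distrib)
  also have "cnj z + z = of_real (2 * Re z)" by (simp add: complex_eq_iff)
  finally have "norm (1 / z + z / (of_real R)\<^sup>2) = 2 * \<bar>Re z\<bar> / R\<^sup>2"
    by (simp add: norm_divide norm_power norm_mult)
  then show ?thesis
    using norm_exp_ln[OF assms(3), of z] by (simp add: newman_kernel_def norm_mult)
qed

text \<open>As \<open>(Im z)^2 = R^2\<close>, the number \<open>R^2 + z^2\<close> has the factor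
  \<open>Re z\<close> and is only of order \<open>R\<close>. The resulting \<open>1 / R^2\<close>,
  better than the \<open>1 / R\<close> of a bare pole, absorbs the linear growth of
  \<open>G\<close>.\<close>

lemma norm_newman_kernel_horizontal:
  assumes "\<bar>Im z\<bar> = R" "- 1 \<le> Re z" "Re z \<le> 0" "R \<ge> 1" "N \<ge> 1"
  shows "norm (newman_kernel (ln (real N)) R z) \<le> 3 / R\<^sup>2"
proof -
  have nz: "norm z \<ge> R" using abs_Im_le_cmod[of z] assms by simp
  then have "z \<noteq> 0" using assms by auto
  have Im2: "(Im z)\<^sup>2 = R\<^sup>2" using assms(1) by (metis power2_abs)
  have "(of_real R)\<^sup>2 + z\<^sup>2 = of_real (Re z) * (of_real (Re z) + 2 * \<i> * of_real (Im z))"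
    using Im2 by (simp add: complex_eq_iff power2_eq_square algebra_simps)
  also have "norm \<dots> \<le> 1 * (\<bar>Re z\<bar> + 2 * \<bar>Im z\<bar>)"
    unfolding norm_mult using assms
    by (intro mult_mono order_trans[OF norm_triangle_ineq]) (auto simp: norm_mult)
  also have "\<dots> \<le> 3 * R" using assms by simp
  finally have num: "norm ((of_real R)\<^sup>2 + z\<^sup>2) \<le> 3 * R" .
  have "1 / z + z / (of_real R)\<^sup>2 = ((of_real R)\<^sup>2 + z\<^sup>2) / (z * (of_real R)\<^sup>2)"
    using \<open>z \<noteq> 0\<close> assms by (simp add: field_simps power2_eq_square)
  then have "norm (1 / z + z / (of_real R)\<^sup>2) = norm ((of_real R)\<^sup>2 + z\<^sup>2) / (norm z * R\<^sup>2)"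
    by (simp add: norm_divide norm_mult norm_power)
  also have "\<dots> \<le> 3 * R / (R * R\<^sup>2)"
    using num nz assms by (intro frac_le mult_mono) auto
  also have "\<dots> = 3 / R\<^sup>2" using assms by simp
  finally have *: "norm (1 / z + z / (of_real R)\<^sup>2) \<le> 3 / R\<^sup>2" .
  have "real N powr Re z \<le> real N powr 0" using assms by (intro powr_mono) auto
  then have "real N powr Re z * norm (1 / z + z / (of_real R)\<^sup>2) \<le> 1 * (3 / R\<^sup>2)"
    using * assms by (intro mult_mono) auto
  then show ?thesis using norm_exp_ln[OF assms(5), of z] by (simp add: newman_kernel_def norm_mult)
qed

lemma norm_newman_kernel_vertical:
  assumes "Re z = - \<eta>" "\<bar>Im z\<bar> \<le> R" "0 < \<eta>" "\<eta> \<le> 1" "R \<ge> 1" "N \<ge> 1"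
  shows "norm (newman_kernel (ln (real N)) R z) \<le> real N powr (- \<eta>) * (1 / \<eta> + 2)"
proof -
  have "norm z \<le> \<eta> + R" using cmod_le[of z] assms by simp
  then have up: "norm z \<le> 2 * R" using assms by simp
  have low: "norm z \<ge> \<eta>" using abs_Re_le_cmod[of z] assms by simp
  have "norm (1 / z + z / (of_real R)\<^sup>2) \<le> 1 / norm z + norm z / R\<^sup>2"
    using norm_triangle_ineq[of "1 / z" "z / (of_real R)\<^sup>2"] by (simp add: norm_divide norm_power)
  also have "\<dots> \<le> 1 / \<eta> + 2 * R / R\<^sup>2"
    using low up assms by (intro add_mono frac_le divide_right_mono) auto
  also have "2 * R / R\<^sup>2 \<le> 2" using assms by (simp add: power2_eq_square divide_simps)
  finally have "norm (1 / z + z / (of_real R)\<^sup>2) \<le> 1 / \<eta> + 2" by simp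
  then show ?thesis using norm_exp_ln[OF assms(6), of z] assms(1)
    by (simp add: newman_kernel_def norm_mult mult_left_mono)
qed

text \<open>Newman's contour argument with a growth bound. The kernel vanishes at \<open>\<plusminus>\<i>R\<close>, which
  compensates the factor \<open>1 / \<bar>Re z\<bar>\<close> in the trivial bounds for the partial sums and the tails; the
  choice \<open>R = N\<^bsup>\<eta>/3\<^esup>\<close> balances the error \<open>1 / R\<close> against \<open>R\<^sup>2 N\<^bsup>-\<eta>\<^esup>\<close> from the shifted line.\<close>

theorem newman_power_saving:
  fixes a :: "nat \<Rightarrow> real"
  assumes a: "\<And>n. n \<ge> 1 \<Longrightarrow> \<bar>a n\<bar> \<le> 1"
    and G: "G holomorphic_on {z. Re z > - \<epsilon>}" and \<eta>: "0 < \<eta>" "\<eta> < \<epsilon>" "\<eta> \<le> 1"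
    and G_eq: "\<And>z. Re z > 0 \<Longrightarrow> G z = dirichlet_series a (1 + z)"
    and growth: "\<And>z. - \<eta> \<le> Re z \<Longrightarrow> Re z \<le> 0 \<Longrightarrow> norm (G z) \<le> C * (1 + norm z)"
  obtains K where "\<And>N. N \<ge> 1 \<Longrightarrow>
      norm (G 0 - of_real (\<Sum>n<N. a (Suc n) / real (Suc n))) \<le> K * real N powr (- (\<eta> / 3))"
proof -
  have C: "C \<ge> 0" using order_trans[OF norm_ge_zero growth[of 0]] \<eta> by simp
  \<comment> \<open>The arcs contribute \<open>6 * pi\<close>, the two horizontal sides
    \<open>18 * C\<close> and the vertical side the rest; \<open>2 * pi\<close> is the normalisation
    in Cauchy's formula.\<close>
  define K where "K = (6 * pi + 18 * C + 6 * C * (1 / \<eta> + 2)) / (2 * pi)"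
  have "norm (G 0 - of_real (\<Sum>n<N. a (Suc n) / real (Suc n))) \<le> K * real N powr (- (\<eta> / 3))"
    if N: "N \<ge> 1" for N
  proof -
    define R where "R = real N powr (\<eta> / 3)"
    have R: "R \<ge> 1" using N \<eta> by (simp add: R_def ge_one_powr_ge_zero)
    then have R0: "R > 0" by simp
    define k where "k = newman_kernel (ln (real N)) R"
    define S :: "complex \<Rightarrow> complex" where "S = (\<lambda>z. \<Sum>n<N. of_real (a (Suc n)) * of_nat (Suc n) powr (- (1 + z)))"
    have S0: "S 0 = of_real (\<Sum>n<N. a (Suc n) / real (Suc n))"
    proof -
      have "of_real (a (Suc n)) * of_nat (Suc n) powr (- (1 + 0)) = complex_of_real (a (Suc n) / real (Suc n))" for n
        using powr_minus[of "of_nat (Suc n) :: complex" 1] by (simp add: divide_inverse del: of_nat_Suc)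
      then show ?thesis by (simp only: S_def of_real_sum)
    qed
    have S_hol: "S holomorphic_on UNIV"
      unfolding S_def by (intro holomorphic_intros)
    \<comment> \<open>\<open>G\<close> continues only to a strip left of the imaginary axis, so its
      contour is closed by a rectangle; the partial sum \<open>S\<close> is entire and may use the
      full circle.\<close>
    define \<gamma>\<^sub>0 where "\<gamma>\<^sub>0 = part_circlepath 0 R (- pi / 2) (pi / 2)"
    define \<gamma>\<^sub>1 where "\<gamma>\<^sub>1 = part_circlepath 0 R (pi / 2) (3 * pi / 2)"
    define h\<^sub>1 where "h\<^sub>1 = linepath (\<i> * of_real R) (Complex (- \<eta>) R)"
    define h\<^sub>2 where "h\<^sub>2 = linepath (Complex (- \<eta>) R) (Complex (- \<eta>) (- R))"
    define h\<^sub>3 where "h\<^sub>3 = linepath (Complex (- \<eta>) (- R)) (- \<i> * of_real R)"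
    define \<gamma>\<^sub>2 where "\<gamma>\<^sub>2 = h\<^sub>1 +++ h\<^sub>2 +++ h\<^sub>3"
    have norm_term: "norm (of_real (a (Suc n)) * of_nat (Suc n) powr (- (1 + z)) :: complex)
          \<le> real (Suc n) powr (- 1 - Re z)" for n z
    proof -
      have "norm (of_real (a (Suc n)) * of_nat (Suc n) powr (- (1 + z)) :: complex)
         = \<bar>a (Suc n)\<bar> * real (Suc n) powr (- 1 - Re z)"
        by (simp add: norm_mult norm_of_nat_powr del: of_nat_Suc)
      also have "\<dots> \<le> 1 * real (Suc n) powr (- 1 - Re z)"
        using a[of "Suc n"] by (intro mult_right_mono) auto
      finally show ?thesis by simp
    qed
    have seg: "x \<in> path_image h\<^sub>1 \<Longrightarrow> Im x = R \<and> - \<eta> \<le> Re x \<and> Re x \<le> 0"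
         "x \<in> path_image h\<^sub>3 \<Longrightarrow> Im x = - R \<and> - \<eta> \<le> Re x \<and> Re x \<le> 0"
         "x \<in> path_image h\<^sub>2 \<Longrightarrow> Re x = - \<eta> \<and> \<bar>Im x\<bar> \<le> R" for x
    proof -
      show "x \<in> path_image h\<^sub>1 \<Longrightarrow> Im x = R \<and> - \<eta> \<le> Re x \<and> Re x \<le> 0"
      proof -
        assume "x \<in> path_image h\<^sub>1"
        then obtain u where u: "0 \<le> u" "u \<le> 1" "x = (1 - u) *\<^sub>R (\<i> * of_real R) + u *\<^sub>R (Complex (- \<eta>) R)"
          by (auto simp: h\<^sub>1_def in_segment)
        have "Re x = - (u * \<eta>)" "Im x = R" unfolding u(3) by (simp_all add: algebra_simps)
        moreover have "0 \<le> u * \<eta>" "u * \<eta> \<le> 1 * \<eta>"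
          using u \<eta> by (auto intro!: mult_right_mono mult_nonneg_nonneg)
        ultimately show ?thesis by simp
      qed
      show "x \<in> path_image h\<^sub>3 \<Longrightarrow> Im x = - R \<and> - \<eta> \<le> Re x \<and> Re x \<le> 0"
      proof -
        assume "x \<in> path_image h\<^sub>3"
        then obtain u where u: "0 \<le> u" "u \<le> 1" "x = (1 - u) *\<^sub>R (Complex (- \<eta>) (- R)) + u *\<^sub>R (- \<i> * of_real R)"
          by (auto simp: h\<^sub>3_def in_segment)
        have "Re x = - ((1 - u) * \<eta>)" "Im x = - R" unfolding u(3) by (simp_all add: algebra_simps)
        moreover have "0 \<le> (1 - u) * \<eta>" "(1 - u) * \<eta> \<le> 1 * \<eta>"
          using u \<eta> by (auto intro!: mult_right_mono mult_nonneg_nonneg)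
        ultimately show ?thesis by simp
      qed
      assume "x \<in> path_image h\<^sub>2"
      then obtain u where u: "0 \<le> u" "u \<le> 1" "x = (1 - u) *\<^sub>R Complex (- \<eta>) R + u *\<^sub>R Complex (- \<eta>) (- R)"
        by (auto simp: h\<^sub>2_def in_segment)
      have "Re x = - \<eta>" "Im x = (1 - 2 * u) * R" unfolding u(3) by (simp_all add: algebra_simps)
      moreover have "\<bar>1 - 2 * u\<bar> * R \<le> 1 * R" using u R by (intro mult_right_mono) auto
      ultimately show "Re x = - \<eta> \<and> \<bar>Im x\<bar> \<le> R" using R by (simp add: abs_mult)
    qed
    have im2: "path_image \<gamma>\<^sub>2 = path_image h\<^sub>1 \<union> (path_image h\<^sub>2 \<union> path_image h\<^sub>3)"
      by (simp add: \<gamma>\<^sub>2_def h\<^sub>1_def h\<^sub>2_def h\<^sub>3_def path_image_join)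
    have vp2: "valid_path \<gamma>\<^sub>2" by (simp add: \<gamma>\<^sub>2_def h\<^sub>1_def h\<^sub>2_def h\<^sub>3_def)
    have arc0: "norm x = R \<and> Re x \<ge> 0" if "x \<in> path_image \<gamma>\<^sub>0" for x
      using that R by (auto simp: \<gamma>\<^sub>0_def path_image_part_circlepath Re_exp norm_mult
          intro!: mult_nonneg_nonneg cos_ge_zero)
    have arc1: "norm x = R \<and> Re x \<le> 0" if x: "x \<in> path_image \<gamma>\<^sub>1" for x
    proof -
      obtain t where t: "x = R * exp (\<i> * of_real t)" "pi / 2 \<le> t" "t \<le> 3 * pi / 2"
        using x by (auto simp: \<gamma>\<^sub>1_def path_image_part_circlepath)
      have "cos (t - pi) \<ge> 0" using t by (intro cos_ge_zero) auto
      then have "cos t \<le> 0" by (simp add: cos_diff)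
      then show ?thesis using t R by (auto simp: Re_exp norm_mult mult_nonneg_nonpos)
    qed
    \<comment> \<open>These are the points of the circle where the bounds with
      \<open>1 / Re z\<close> break down. Being finitely many, they are exempted from the estimates
      on the arcs.\<close>
    have ends: "x \<in> {\<i> * of_real R, - \<i> * of_real R}" if "norm x = R" "Re x = 0" for x
    proof -
      have "\<bar>Im x\<bar> = R" using that by (simp add: cmod_def)
      then have "Im x = R \<or> Im x = - R" by linarith
      then show ?thesis using that by (auto simp: complex_eq_iff)
    qed
    have intG: "(\<lambda>z. G z * k z) contour_integrable_on \<gamma>\<^sub>0" "(\<lambda>z. G z * k z) contour_integrable_on \<gamma>\<^sub>2"
      "contour_integral \<gamma>\<^sub>0 (\<lambda>z. G z * k z) + contour_integral \<gamma>\<^sub>2 (\<lambda>z. G z * k z) = 2 * pi * \<i> * G 0"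
    proof -
      have sub: "path_image \<gamma>\<^sub>2 \<subseteq> {z. Re z > - \<epsilon>}" "path_image \<gamma>\<^sub>2 \<subseteq> {z. Re z \<le> 0} - {0}"
        "path_image \<gamma>\<^sub>0 \<subseteq> {z. Re z > - \<epsilon>}"
        using seg arc0 \<eta> R0 unfolding im2 by fastforce+
      have "pathstart \<gamma>\<^sub>2 = \<i> * of_real R" "pathfinish \<gamma>\<^sub>2 = - \<i> * of_real R"
        by (simp_all add: \<gamma>\<^sub>2_def h\<^sub>1_def h\<^sub>3_def)
      note * = contour_integral_newman_kernel[OF G open_halfspace_Re_gt convex_halfspace_Re_gt _ R0 vp2 this
          sub(1,2) sub(3)[unfolded \<gamma>\<^sub>0_def], folded \<gamma>\<^sub>0_def, of "ln (real N)", folded k_def]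
      show "(\<lambda>z. G z * k z) contour_integrable_on \<gamma>\<^sub>0" "(\<lambda>z. G z * k z) contour_integrable_on \<gamma>\<^sub>2"
      "contour_integral \<gamma>\<^sub>0 (\<lambda>z. G z * k z) + contour_integral \<gamma>\<^sub>2 (\<lambda>z. G z * k z) = 2 * pi * \<i> * G 0"
        using * \<eta> by auto
    qed
    have intS: "(\<lambda>z. S z * k z) contour_integrable_on \<gamma>\<^sub>0" "(\<lambda>z. S z * k z) contour_integrable_on \<gamma>\<^sub>1"
      "contour_integral \<gamma>\<^sub>0 (\<lambda>z. S z * k z) + contour_integral \<gamma>\<^sub>1 (\<lambda>z. S z * k z) = 2 * pi * \<i> * S 0"
    proof -
      have sub: "path_image \<gamma>\<^sub>1 \<subseteq> {z. Re z \<le> 0} - {0}"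
        using arc1 R0 by fastforce
      have "cos (3 * pi / 2) = 0" "sin (3 * pi / 2) = - 1"
        using cos_3over2_pi sin_3over2_pi by (simp_all add: field_simps)
      then have "exp (\<i> * (3 * of_real pi) / 2) = - \<i>"
        using cis_conv_exp[of "3 * pi / 2"] by (simp add: complex_eq_iff)
      then have "pathstart \<gamma>\<^sub>1 = \<i> * of_real R" "pathfinish \<gamma>\<^sub>1 = - \<i> * of_real R"
        using cis_conv_exp[of "pi / 2"] by (simp_all add: \<gamma>\<^sub>1_def)
      note * = contour_integral_newman_kernel[OF S_hol open_UNIV convex_UNIV _ R0 _ this
          subset_UNIV sub subset_UNIV, folded \<gamma>\<^sub>0_def, of "ln (real N)", folded k_def]
      show "(\<lambda>z. S z * k z) contour_integrable_on \<gamma>\<^sub>0" "(\<lambda>z. S z * k z) contour_integrable_on \<gamma>\<^sub>1"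
      "contour_integral \<gamma>\<^sub>0 (\<lambda>z. S z * k z) + contour_integral \<gamma>\<^sub>1 (\<lambda>z. S z * k z) = 2 * pi * \<i> * S 0"
        using * by (auto simp: \<gamma>\<^sub>1_def)
    qed
    \<comment> \<open>The tail is at most \<open>N^(-Re z) / Re z\<close> and the kernel is exactly
      \<open>N^(Re z) * 2 * Re z / R^2\<close> in norm: the product \<open>2 / R^2\<close> is
      uniform on an arc of length \<open>pi * R\<close>.\<close>
    have b0: "norm (contour_integral \<gamma>\<^sub>0 (\<lambda>z. G z * k z - S z * k z)) \<le> 2 * pi / R"
    proof -
      have "norm (contour_integral \<gamma>\<^sub>0 (\<lambda>z. G z * k z - S z * k z)) \<le> 2 / R\<^sup>2 * R * (pi / 2 - (- pi / 2))"
        unfolding \<gamma>\<^sub>0_def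
      proof (rule contour_integral_bound_part_circlepath_strong[where k = "{\<i> * of_real R, - \<i> * of_real R}"])
        show "(\<lambda>z. G z * k z - S z * k z) contour_integrable_on part_circlepath 0 R (- pi / 2) (pi / 2)"
          using intG intS unfolding \<gamma>\<^sub>0_def by (intro contour_integrable_diff)
        fix z assume "z \<in> path_image (part_circlepath 0 R (- pi / 2) (pi / 2)) - {\<i> * of_real R, - \<i> * of_real R}"
        then have z: "norm z = R" "Re z > 0"
          using arc0[of z] ends[of z] unfolding \<gamma>\<^sub>0_def by (auto simp: order_le_less)
        define t where "t = (\<lambda>n. complex_of_real (a (Suc n)) * of_nat (Suc n) powr (- (1 + z)))"
        have nt: "norm (t n) \<le> real (Suc n) powr (- 1 - Re z)" for n
          unfolding t_def by (rule norm_term)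
        have "summable t"
          by (rule summable_comparison_test'[OF summable_Suc_powr[of "- 1 - Re z"], of 0]) (use z nt in auto)
        then have "G z - S z = (\<Sum>n. t (n + N))"
          using suminf_minus_initial_segment[of t N] z by (simp only: G_eq dirichlet_series_def S_def t_def)
        also have "norm \<dots> \<le> (\<Sum>n. real (Suc (n + N)) powr (- 1 - Re z))"
          by (intro norm_suminf_le nt sum_powr_tail_le z N)
        also have "\<dots> \<le> real N powr (- Re z) / Re z"
          by (intro sum_powr_tail_le z N)
        finally have "norm (G z - S z) * norm (k z)
            \<le> real N powr (- Re z) / Re z * (real N powr Re z * (2 * \<bar>Re z\<bar> / R\<^sup>2))"
          using norm_newman_kernel_circle[OF z(1) R0 N] z unfolding k_def by (intro mult_mono) auto
        also have "\<dots> = 2 / R\<^sup>2"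
          using z N by (simp add: powr_minus field_simps)
        finally show "norm (G z * k z - S z * k z) \<le> 2 / R\<^sup>2"
          by (simp add: left_diff_distrib[symmetric] norm_mult)
      qed (use R0 in auto)
      also have "\<dots> = 2 * pi / R" using R0 by (simp add: power2_eq_square)
      finally show ?thesis .
    qed
    \<comment> \<open>The same cancellation with \<open>u = - Re z\<close> and the head of the
      series; its extra \<open>1 / N\<close> survives as \<open>2 * u / (N * R^2)\<close>, and
      \<open>u \<le> R\<close>.\<close>
    have b1: "norm (contour_integral \<gamma>\<^sub>1 (\<lambda>z. S z * k z)) \<le> 2 * pi / R + 2 * pi / real N"
    proof -
      have "norm (contour_integral \<gamma>\<^sub>1 (\<lambda>z. S z * k z)) \<le> (2 / R\<^sup>2 + 2 / (real N * R)) * R * (3 * pi / 2 - pi / 2)"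
        unfolding \<gamma>\<^sub>1_def
      proof (rule contour_integral_bound_part_circlepath_strong[where k = "{\<i> * of_real R, - \<i> * of_real R}"])
        show "(\<lambda>z. S z * k z) contour_integrable_on part_circlepath 0 R (pi / 2) (3 * pi / 2)"
          using intS unfolding \<gamma>\<^sub>1_def by simp
        fix z assume "z \<in> path_image (part_circlepath 0 R (pi / 2) (3 * pi / 2)) - {\<i> * of_real R, - \<i> * of_real R}"
        then have z: "norm z = R" "Re z < 0"
          using arc1[of z] ends[of z] unfolding \<gamma>\<^sub>1_def by (auto simp: order_le_less)
        define u where "u = - Re z"
        have u: "u > 0" "u \<le> R" using z abs_Re_le_cmod[of z] by (auto simp: u_def)
        have "norm (S z) \<le> (\<Sum>n<N. real (Suc n) powr (u - 1))"
          unfolding S_def u_def by (intro sum_norm_le) (subst minus_diff_commute, rule norm_term)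
        also have "\<dots> \<le> real N powr u * (1 / u + 1 / real N)" by (intro sum_powr_head_le u N)
        finally have "norm (S z) * norm (k z)
            \<le> real N powr u * (1 / u + 1 / real N) * (real N powr Re z * (2 * \<bar>Re z\<bar> / R\<^sup>2))"
          using norm_newman_kernel_circle[OF z(1) R0 N] u unfolding k_def by (intro mult_mono) auto
        also have "\<dots> = 2 / R\<^sup>2 + 2 * u / (real N * R\<^sup>2)"
          using u N z(2) R0 by (simp add: u_def powr_minus field_simps)
        also have "2 * u / (real N * R\<^sup>2) \<le> 2 * R / (real N * R\<^sup>2)"
          using u N by (intro divide_right_mono) auto
        also have "2 * R / (real N * R\<^sup>2) = 2 / (real N * R)" using R0 by (simp add: power2_eq_square)
        finally show "norm (S z * k z) \<le> 2 / R\<^sup>2 + 2 / (real N * R)"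
          by (simp add: norm_mult)
      qed (use R0 N in auto)
      also have "\<dots> = 2 * pi / R + 2 * pi / real N" using R0 N by (simp add: power2_eq_square field_simps)
      finally show ?thesis .
    qed
    have Gb: "norm (G x) \<le> 3 * C * R" if "- \<eta> \<le> Re x" "Re x \<le> 0" "\<bar>Im x\<bar> \<le> R" for x
    proof -
      have "norm (G x) \<le> C * (1 + norm x)" by (rule growth) fact+
      also have "\<dots> \<le> C * (3 * R)"
        using cmod_le[of x] that \<eta> R C by (intro mult_left_mono) auto
      finally show ?thesis by simp
    qed
    have inth: "(\<lambda>z. G z * k z) contour_integrable_on h\<^sub>1" "(\<lambda>z. G z * k z) contour_integrable_on h\<^sub>2"
      "(\<lambda>z. G z * k z) contour_integrable_on h\<^sub>3"
      using intG(2) by (simp_all add: \<gamma>\<^sub>2_def h\<^sub>1_def h\<^sub>2_def h\<^sub>3_def)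
    have horiz: "norm (G x * k x) \<le> 9 * C / R" if "\<bar>Im x\<bar> = R" "- \<eta> \<le> Re x" "Re x \<le> 0" for x
    proof -
      have "norm (G x) * norm (k x) \<le> 3 * C * R * (3 / R\<^sup>2)"
        unfolding k_def using that R0 C \<eta> R N
        by (intro mult_mono Gb norm_newman_kernel_horizontal) auto
      also have "\<dots> = 9 * C / R" using R0 by (simp add: power2_eq_square)
      finally show ?thesis by (simp add: norm_mult)
    qed
    have c1: "norm (contour_integral h\<^sub>1 (\<lambda>z. G z * k z)) \<le> 9 * C / R"
    proof -
      have "norm (contour_integral h\<^sub>1 (\<lambda>z. G z * k z)) \<le> 9 * C / R * norm (Complex (- \<eta>) R - \<i> * of_real R)"
        unfolding h\<^sub>1_def
        by (rule contour_integral_bound_linepath) (use inth horiz seg C R0 in \<open>auto simp: h\<^sub>1_def\<close>)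
      also have "Complex (- \<eta>) R - \<i> * of_real R = of_real (- \<eta>)" by (simp add: complex_eq_iff)
      also have "9 * C / R * norm (complex_of_real (- \<eta>)) \<le> 9 * C / R * 1"
        using C R0 \<eta> by (intro mult_left_mono) auto
      finally show ?thesis by simp
    qed
    have c3: "norm (contour_integral h\<^sub>3 (\<lambda>z. G z * k z)) \<le> 9 * C / R"
    proof -
      have "norm (contour_integral h\<^sub>3 (\<lambda>z. G z * k z)) \<le> 9 * C / R * norm (- \<i> * of_real R - Complex (- \<eta>) (- R))"
        unfolding h\<^sub>3_def
        by (rule contour_integral_bound_linepath) (use inth horiz seg C R0 in \<open>auto simp: h\<^sub>3_def\<close>)
      also have "- \<i> * of_real R - Complex (- \<eta>) (- R) = of_real \<eta>" by (simp add: complex_eq_iff)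
      also have "9 * C / R * norm (complex_of_real \<eta>) \<le> 9 * C / R * 1"
        using C R0 \<eta> by (intro mult_left_mono) auto
      finally show ?thesis by simp
    qed
    \<comment> \<open>Growth \<open>3 * C * R\<close> and length \<open>2 * R\<close> cost
      \<open>R^2\<close>; the shifted line saves \<open>N^(-\<eta>)\<close>.\<close>
    have c2: "norm (contour_integral h\<^sub>2 (\<lambda>z. G z * k z)) \<le> 6 * C * (1 / \<eta> + 2) * (R\<^sup>2 * real N powr (- \<eta>))"
    proof -
      have "norm (contour_integral h\<^sub>2 (\<lambda>z. G z * k z))
          \<le> 3 * C * R * (real N powr (- \<eta>) * (1 / \<eta> + 2)) * norm (Complex (- \<eta>) (- R) - Complex (- \<eta>) R)"
        unfolding h\<^sub>2_def
      proof (rule contour_integral_bound_linepath)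
        fix x assume "x \<in> closed_segment (Complex (- \<eta>) R) (Complex (- \<eta>) (- R))"
        then have x: "Re x = - \<eta>" "\<bar>Im x\<bar> \<le> R" using seg(3)[of x] by (auto simp: h\<^sub>2_def)
        show "norm (G x * k x) \<le> 3 * C * R * (real N powr (- \<eta>) * (1 / \<eta> + 2))"
          unfolding norm_mult k_def using x R0 C \<eta> R N
          by (intro mult_mono Gb norm_newman_kernel_vertical) auto
      qed (use inth C R0 \<eta> in \<open>auto simp: h\<^sub>2_def\<close>)
      also have "Complex (- \<eta>) (- R) - Complex (- \<eta>) R = of_real (- 2 * R) * \<i>" by (simp add: complex_eq_iff)
      also have "norm (of_real (- 2 * R) * \<i>) = 2 * R" using R0 by (simp add: norm_mult)
      finally show ?thesis by (simp add: power2_eq_square algebra_simps)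
    qed
    have i2: "contour_integral \<gamma>\<^sub>2 (\<lambda>z. G z * k z) = contour_integral h\<^sub>1 (\<lambda>z. G z * k z)
       + contour_integral h\<^sub>2 (\<lambda>z. G z * k z) + contour_integral h\<^sub>3 (\<lambda>z. G z * k z)"
      using inth by (simp add: \<gamma>\<^sub>2_def h\<^sub>1_def h\<^sub>2_def h\<^sub>3_def)
    have "2 * pi * \<i> * (G 0 - S 0) = contour_integral \<gamma>\<^sub>0 (\<lambda>z. G z * k z - S z * k z)
        + contour_integral h\<^sub>1 (\<lambda>z. G z * k z) + contour_integral h\<^sub>2 (\<lambda>z. G z * k z)
        + contour_integral h\<^sub>3 (\<lambda>z. G z * k z) - contour_integral \<gamma>\<^sub>1 (\<lambda>z. S z * k z)"
      unfolding right_diff_distrib intG(3)[symmetric] intS(3)[symmetric] i2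
        contour_integral_diff[OF intG(1) intS(1)] by simp
    also have "norm \<dots> \<le> 2 * pi / R + 9 * C / R + 6 * C * (1 / \<eta> + 2) * (R\<^sup>2 * real N powr (- \<eta>)) + 9 * C / R
        + (2 * pi / R + 2 * pi / real N)"
      by (intro order_trans[OF norm_triangle_ineq4] order_trans[OF norm_triangle_ineq] add_mono b0 b1 c1 c2 c3)
    also have "\<dots> \<le> (6 * pi + 18 * C + 6 * C * (1 / \<eta> + 2)) * real N powr (- (\<eta> / 3))"
    proof -
      have 1: "1 / R = real N powr (- (\<eta> / 3))" by (simp add: R_def powr_minus_divide)
      have 2: "R\<^sup>2 * real N powr (- \<eta>) = real N powr (- (\<eta> / 3))"
        by (simp add: R_def power2_eq_square powr_add[symmetric])
      have "real N powr (- 1) \<le> real N powr (- (\<eta> / 3))"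
        using N \<eta> by (intro powr_mono) auto
      then have 3: "1 / real N \<le> real N powr (- (\<eta> / 3))" using N by (simp add: powr_minus_divide)
      have "2 * pi * (1 / real N) \<le> 2 * pi * real N powr (- (\<eta> / 3))"
        using 3 by (intro mult_left_mono) auto
      moreover have "2 * pi / R = 2 * pi * real N powr (- (\<eta> / 3))" "9 * C / R = 9 * C * real N powr (- (\<eta> / 3))"
        by (simp_all add: 1[symmetric])
      ultimately show ?thesis unfolding 2 by (simp add: algebra_simps)
    qed
    finally have "norm (2 * pi * \<i> * (G 0 - S 0)) \<le> \<dots>" .
    moreover have "norm (2 * pi * \<i> * (G 0 - S 0)) = 2 * pi * norm (G 0 - S 0)"
      by (simp add: norm_mult)
    ultimately have "norm (G 0 - S 0) \<le> K * real N powr (- (\<eta> / 3))"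
      by (simp add: K_def pos_le_divide_eq mult.commute)
    then show ?thesis by (simp only: S0)
  qed
  then show ?thesis using that by blast
qed

section \<open>Prime sums of a completely multiplicative function\<close>

text \<open>The little-o estimate controls all but finitely many \<open>n\<close>, and
  \<open>C\<close> absorbs the rest. Passing to a smaller \<open>\<delta>'\<close> keeps the
  exponent nonnegative, as the Dirichlet series lemmas require, when \<open>\<delta>\<close> exceeds
  1.\<close>

lemma small_on_average_bound:
  assumes "small_on_average f \<delta>" "\<delta>' \<le> \<delta>"
  obtains C where "\<And>n. n \<ge> 1 \<Longrightarrow> \<bar>sum f {1..n}\<bar> \<le> C * real n powr (1 - \<delta>')"
proof -
  have set_eq: "{k. 1 \<le> k \<and> real k \<le> real n} = {1..n}" for n by auto
  have "eventually (\<lambda>x::real. norm (\<Sum>n | 1 \<le> n \<and> real n \<le> x. f n) \<le> 1 * norm (x powr (1 - \<delta>))) at_top"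
    using landau_o.smallD[OF assms(1)[unfolded small_on_average_def], of 1] by simp
  then obtain X where X: "\<And>x. x \<ge> X \<Longrightarrow> norm (\<Sum>n | 1 \<le> n \<and> real n \<le> x. f n) \<le> 1 * norm (x powr (1 - \<delta>))"
    by (auto simp: eventually_at_top_linorder)
  define M where "M = nat \<lceil>X\<rceil>"
  define C where "C = 1 + (\<Sum>k\<le>M. \<bar>sum f {1..k}\<bar> / real k powr (1 - \<delta>'))"
  have C: "C \<ge> 1" by (simp add: C_def sum_nonneg)
  have "\<bar>sum f {1..n}\<bar> \<le> C * real n powr (1 - \<delta>')" if n: "n \<ge> 1" for n
  proof (cases "n \<le> M")
    case True
    have "\<bar>sum f {1..n}\<bar> / real n powr (1 - \<delta>') \<le> (\<Sum>k\<le>M. \<bar>sum f {1..k}\<bar> / real k powr (1 - \<delta>'))"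
      using True by (intro member_le_sum) auto
    then have "\<bar>sum f {1..n}\<bar> / real n powr (1 - \<delta>') \<le> C" by (simp add: C_def)
    then show ?thesis using n by (simp add: divide_le_eq)
  next
    case False
    then have "real n \<ge> X" unfolding M_def by linarith
    then have "\<bar>sum f {1..n}\<bar> \<le> real n powr (1 - \<delta>)" using X[of "real n"] set_eq[of n] by simp
    also have "\<dots> \<le> 1 * real n powr (1 - \<delta>')" using n assms(2) by (auto intro!: powr_mono)
    also have "\<dots> \<le> C * real n powr (1 - \<delta>')" using C by (intro mult_right_mono) auto
    finally show ?thesis .
  qed
  then show ?thesis using that by blast
qed

lemma prime_partial_sum_eq:
  assumes "x \<ge> 0"
  shows "prime_partial_sum f \<sigma> x = (\<Sum>n=1..nat \<lfloor>x\<rfloor>. (if prime n then f n else 0) * real n powr (- \<sigma>))"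
proof -
  have "{p. prime p \<and> real p \<le> x} = {n\<in>{1..nat \<lfloor>x\<rfloor>}. prime n}"
    using assms by (auto simp: prime_ge_1_nat le_nat_iff le_floor_iff dest: prime_ge_1_nat)
  then have "prime_partial_sum f \<sigma> x = (\<Sum>n\<in>{n\<in>{1..nat \<lfloor>x\<rfloor>}. prime n}. f n * real n powr (- \<sigma>))"
    by (simp add: prime_partial_sum_def)
  also have "\<dots> = (\<Sum>n=1..nat \<lfloor>x\<rfloor>. if prime n then f n * real n powr (- \<sigma>) else 0)"
    by (rule sum.inter_filter) simp
  also have "\<dots> = (\<Sum>n=1..nat \<lfloor>x\<rfloor>. (if prime n then f n else 0) * real n powr (- \<sigma>))"
    by (intro sum.cong) auto
  finally show ?thesis .
qed

text \<open>\<open>exp (u - v)\<close> is constantly 1 and exponentials never vanish, so the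
  derivative of \<open>u - v\<close> is 0.\<close>

lemma exp_eq_imp_diff_const:
  assumes A: "open A" "convex A" and hol: "u holomorphic_on A" "v holomorphic_on A"
    and eq: "\<And>z. z \<in> A \<Longrightarrow> exp (u z) = exp (v z)"
  obtains c :: complex where "\<And>z. z \<in> A \<Longrightarrow> u z = v z + c"
proof -
  have D0: "((\<lambda>z. u z - v z) has_field_derivative 0) (at z within A)" if z: "z \<in> A" for z
  proof -
    have "(\<lambda>z. u z - v z) holomorphic_on A" by (intro holomorphic_intros hol)
    then obtain D where D: "((\<lambda>z. u z - v z) has_field_derivative D) (at z)"
      using A(1) z by (meson field_differentiable_def holomorphic_on_imp_differentiable_at)
    have "((\<lambda>z. exp (u z - v z)) has_field_derivative exp (u z - v z) * D) (at z)"
      by (rule DERIV_fun_exp[OF D])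
    then have "((\<lambda>_. 1) has_field_derivative exp (u z - v z) * D) (at z)"
      by (rule has_field_derivative_transform_within_open[OF _ A(1) z]) (use eq in \<open>auto simp: exp_diff\<close>)
    then have "exp (u z - v z) * D = 0" using DERIV_unique DERIV_const by blast
    then show ?thesis using has_field_derivative_at_within[OF D] by simp
  qed
  obtain c where "\<And>z. z \<in> A \<Longrightarrow> u z - v z = c"
    using has_field_derivative_zero_constant[OF A(2) D0] by blast
  then show ?thesis using that by (metis add.commute diff_add_cancel)
qed

lemma dirichlet_series_shift:
  "dirichlet_series (\<lambda>n. a n * real n powr (- x)) s = dirichlet_series a (s + of_real x)"
proof -
  have "of_real (a (Suc n) * real (Suc n) powr (- x)) * of_nat (Suc n) powr (- s)
      = of_real (a (Suc n)) * of_nat (Suc n) powr (- (s + of_real x))" for n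
  proof -
    have "complex_of_real (real (Suc n) powr (- x)) = of_nat (Suc n) powr (- of_real x)"
      by (subst powr_of_real[symmetric]) auto
    then show ?thesis
      by (simp add: powr_add[symmetric] add.commute del: of_nat_Suc)
  qed
  then show ?thesis by (simp only: dirichlet_series_def)
qed

text \<open>When all earlier coefficients vanish, the \<open>m\<close>-th term equals minus the tail
  behind it. At exponent \<open>1 + x\<close> this gives \<open>\<bar>g m\<bar> \<le> m / x\<close>,
  and \<open>x\<close> may be arbitrarily large.\<close>

lemma dirichlet_series_eq_0_imp:
  fixes g :: "nat \<Rightarrow> real"
  assumes g: "\<And>n. n \<ge> 1 \<Longrightarrow> \<bar>g n\<bar> \<le> 1"
    and zero: "\<And>x::real. x > 1 \<Longrightarrow> dirichlet_series g (of_real x) = 0" and "n \<ge> 1"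
  shows "g n = 0"
  using \<open>n \<ge> 1\<close>
proof (induction n rule: less_induct)
  case (less m)
  have bound: "norm (complex_of_real (g m)) \<le> real m * (1 / x)" if x: "x > 0" for x :: real
  proof -
    define t where "t = (\<lambda>n. complex_of_real (g (Suc n)) * of_nat (Suc n) powr (- of_real (1 + x)))"
    have nt: "norm (t n) \<le> real (Suc n) powr (- 1 - x)" for n
    proof -
      have "norm (t n) = \<bar>g (Suc n)\<bar> * real (Suc n) powr (- 1 - x)"
        by (simp add: t_def norm_mult norm_of_nat_powr del: of_nat_Suc)
      also have "\<dots> \<le> 1 * real (Suc n) powr (- 1 - x)" using g[of "Suc n"] by (intro mult_right_mono) auto
      finally show ?thesis by simp
    qed
    have "summable t"
      by (rule summable_comparison_test'[OF summable_Suc_powr[of "- 1 - x"], of 0]) (use x nt in auto)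
    then have "(\<Sum>n. t (n + m)) = suminf t - (\<Sum>n<m. t n)" by (rule suminf_minus_initial_segment)
    also have "suminf t = 0" using zero[of "1 + x"] x by (simp add: dirichlet_series_def t_def)
    also have "(\<Sum>n<m. t n) = (\<Sum>n\<in>{m - 1}. t n)"
      using less by (intro sum.mono_neutral_right) (auto simp: t_def)
    finally have "norm (t (m - 1)) = norm (\<Sum>n. t (n + m))" by simp
    also have "\<dots> \<le> (\<Sum>n. real (Suc (n + m)) powr (- 1 - x))"
      by (intro norm_suminf_le nt sum_powr_tail_le x less.prems)
    also have "\<dots> \<le> real m powr (- x) / x" by (intro sum_powr_tail_le x less.prems)
    finally have "norm (complex_of_real (g m)) * real m powr (- 1 - x) \<le> real m powr (- x) / x"
      using less.prems by (simp add: t_def norm_mult norm_of_nat_powr)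
    also have "\<dots> = (real m * (1 / x)) * real m powr (- 1 - x)"
      using less.prems by (simp add: powr_diff powr_minus_divide)
    finally show ?thesis by (rule mult_right_le_imp_le) (use less.prems in auto)
  qed
  have "((\<lambda>x. real m * (1 / x)) \<longlongrightarrow> real m * 0) at_top"
    by (intro tendsto_mult_left tendsto_divide_0[OF tendsto_const] filterlim_ident filterlim_at_top_imp_at_infinity)
  then have "norm (complex_of_real (g m)) \<le> real m * 0"
    by (rule tendsto_lowerbound[OF _ eventually_mono[OF eventually_gt_at_top[of 0] bound]]) auto
  then show ?case by simp
qed

text \<open>Summation by parts against the remainders \<open>R N\<close> instead of the partial
  sums: the contribution of \<open>B\<close>, which would be of order \<open>N\<close>,
  cancels.\<close>

lemma weighted_sum_power_saving:
  fixes b :: "nat \<Rightarrow> real"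
  assumes b: "\<And>N. N \<ge> 1 \<Longrightarrow> \<bar>B - sum b {1..N}\<bar> \<le> K * real N powr (- \<theta>)" and \<theta>: "0 < \<theta>" "\<theta> < 1"
  obtains C where "\<And>N. N \<ge> 1 \<Longrightarrow> \<bar>\<Sum>n=1..N. real n * b n\<bar> \<le> C * real N powr (1 - \<theta>)"
proof -
  have K: "K \<ge> 0" using order_trans[OF abs_ge_zero b[of 1]] by simp
  define R where "R = (\<lambda>N. sum b {1..N} - B)"
  have R: "\<bar>R N\<bar> \<le> K * real N powr (- \<theta>)" if "N \<ge> 1" for N
    using b[OF that] by (simp only: R_def abs_minus_commute)
  define C where "C = K + \<bar>B\<bar> + K * (1 / (1 - \<theta>) + 1)"
  have "\<bar>\<Sum>n=1..N. real n * b n\<bar> \<le> C * real N powr (1 - \<theta>)" if N: "N \<ge> 1" for N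
  proof -
    have "(\<Sum>n=1..N. real n * b n) = real N * R N - (\<Sum>n<N. R n)"
      by (induction N) (simp_all add: R_def algebra_simps)
    \<comment> \<open>\<open>R 0 = - B\<close> comes from the empty sum and is not covered by the
      bound, so it is split off.\<close>
    also have "(\<Sum>n<N. R n) = - B + (\<Sum>n<N - 1. R (Suc n))"
      using sum.lessThan_Suc_shift[of R "N - 1"] N by (simp add: R_def del: sum.lessThan_Suc)
    also have "\<bar>real N * R N - (- B + (\<Sum>n<N - 1. R (Suc n)))\<bar> \<le> \<bar>real N * R N\<bar> + \<bar>B\<bar> + \<bar>\<Sum>n<N - 1. R (Suc n)\<bar>"
      by linarith
    also have "\<bar>real N * R N\<bar> \<le> real N * (K * real N powr (- \<theta>))"
      using R[OF N] by (simp add: abs_mult mult_left_mono)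
    also have "real N * (K * real N powr (- \<theta>)) = K * real N powr (1 - \<theta>)"
      using N by (simp add: powr_diff powr_minus_divide)
    also have "\<bar>B\<bar> \<le> \<bar>B\<bar> * real N powr (1 - \<theta>)"
      using N \<theta> by (simp add: mult_le_cancel_left1 ge_one_powr_ge_zero)
    also have "\<bar>\<Sum>n<N - 1. R (Suc n)\<bar> \<le> (\<Sum>n<N - 1. K * real (Suc n) powr (- \<theta>))"
      using R by (intro order_trans[OF sum_abs] sum_mono) (simp del: of_nat_Suc)
    also have "\<dots> \<le> (\<Sum>n<N. K * real (Suc n) powr (- \<theta>))"
      using K by (intro sum_mono2) auto
    also have "\<dots> = K * (\<Sum>n<N. real (Suc n) powr ((1 - \<theta>) - 1))"
      by (simp add: sum_distrib_left)
    also have "\<dots> \<le> K * (real N powr (1 - \<theta>) * (1 / (1 - \<theta>) + 1 / real N))"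
      using K \<theta> N by (intro mult_left_mono sum_powr_head_le) auto
    also have "\<dots> \<le> K * (real N powr (1 - \<theta>) * (1 / (1 - \<theta>) + 1))"
      using K N by (intro mult_left_mono add_left_mono) auto
    finally show ?thesis by (simp add: C_def algebra_simps)
  qed
  then show ?thesis using that by blast
qed

section \<open>The prime series and its relation to logarithms of \<open>F\<close>\<close>

locale small_completely_multiplicative =
  fixes f :: "nat \<Rightarrow> real" and \<delta> :: real
  assumes f_bound: "\<And>n. n \<ge> 1 \<Longrightarrow> \<bar>f n\<bar> \<le> 1"
    and cm: "completely_multiplicative f"
    and small: "small_on_average f \<delta>"
begin

definition f_primes :: "nat \<Rightarrow> real" where "f_primes n = (if prime n then f n else 0)"

lemma f_primes_bound: "n \<ge> 1 \<Longrightarrow> \<bar>f_primes n\<bar> \<le> 1" and f_primes_1: "f_primes 1 = 0"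
  using f_bound by (auto simp: f_primes_def)

lemma f_primes_sum_bound: "n \<ge> 1 \<Longrightarrow> \<bar>sum f_primes {1..n}\<bar> \<le> 1 * real n powr 1"
  using abs_sum_powr_le[of f_primes 1 0 n] f_primes_bound by simp

lemma f_primes_holomorphic: "dirichlet_series f_primes holomorphic_on {s. Re s > 1}"
  by (rule dirichlet_series_holomorphic[OF f_primes_sum_bound]) auto

lemma f_eq_exp: "Re s > 1 \<Longrightarrow> dirichlet_series f s = exp (dirichlet_series f_primes s + log_remainder f_primes s)"
  using dirichlet_series_eq_exp[OF cm f_bound, of s] by (simp add: f_primes_def[abs_def])

lemma log_remainder_hol: "log_remainder f_primes holomorphic_on {s. Re s > 3/4}"
  by (rule log_remainder_holomorphic[where g = f_primes, OF f_primes_1 f_primes_bound])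

lemma f_holomorphic:
  assumes "\<delta>' \<le> \<delta>" "\<delta>' \<le> 1"
  shows "dirichlet_series f holomorphic_on {s. Re s > 1 - \<delta>'}"
proof -
  obtain C where "\<And>n. n \<ge> 1 \<Longrightarrow> \<bar>sum f {1..n}\<bar> \<le> C * real n powr (1 - \<delta>')"
    using small_on_average_bound[OF small assms(1)] by blast
  then show ?thesis by (rule dirichlet_series_holomorphic) (use assms in auto)
qed

text \<open>Both sides are logarithms of \<open>F\<close> on the convex set
  \<open>A \<inter> {s. Re s > 1}\<close>. This serves with a half plane as \<open>A\<close> in one
  direction and a disc around 1 in the other.\<close>

lemma log_continues_prime_series:
  assumes A: "open A" "convex A" and L: "L holomorphic_on A"
    and exp_L: "\<And>s. s \<in> A \<Longrightarrow> exp (L s) = dirichlet_series f s"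
  obtains c where "\<And>s. s \<in> A \<Longrightarrow> Re s > 1 \<Longrightarrow> L s = dirichlet_series f_primes s + log_remainder f_primes s + c"
proof -
  define U where "U = A \<inter> {s. Re s > 1}"
  have U: "open U" "convex U" unfolding U_def
    using A by (auto intro!: open_Int convex_Int open_halfspace_Re_gt convex_halfspace_Re_gt)
  have "L holomorphic_on U"
    by (rule holomorphic_on_subset[OF L]) (auto simp: U_def)
  moreover have "(\<lambda>s. dirichlet_series f_primes s + log_remainder f_primes s) holomorphic_on U"
    by (intro holomorphic_intros holomorphic_on_subset[OF f_primes_holomorphic] holomorphic_on_subset[OF log_remainder_hol])
      (auto simp: U_def)
  moreover have "exp (L s) = exp (dirichlet_series f_primes s + log_remainder f_primes s)" if "s \<in> U" for s
    using that exp_L f_eq_exp by (auto simp: U_def)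
  ultimately obtain c where "\<And>s. s \<in> U \<Longrightarrow> L s = dirichlet_series f_primes s + log_remainder f_primes s + c"
    using exp_eq_imp_diff_const[OF U] by blast
  then show ?thesis using that by (auto simp: U_def)
qed

section \<open>From a zero-free half plane to an eventually constant sign\<close>

lemma prime_sum_power_saving:
  assumes \<epsilon>: "0 < \<epsilon>" "\<epsilon> \<le> \<delta>" and nz: "\<And>s. Re s > 1 - \<epsilon> \<Longrightarrow> dirichlet_series f s \<noteq> 0"
  obtains \<theta> C where "0 < \<theta>" "\<theta> < 1" "\<And>N. N \<ge> 1 \<Longrightarrow> \<bar>sum f_primes {1..N}\<bar> \<le> C * real N powr (1 - \<theta>)"
proof -
  \<comment> \<open>The cap 1/4 keeps the strip in \<open>Re s > 3/4\<close>, where the log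
    remainder is holomorphic and bounded.\<close>
  define e where "e = min \<epsilon> (1/4)"
  have e: "0 < e" "e \<le> \<epsilon>" "e \<le> 1/4" using \<epsilon> by (auto simp: e_def)
  have F: "dirichlet_series f holomorphic_on {s. Re s > 1 - e}"
    using f_holomorphic[of e] e \<epsilon> by simp
  obtain L where L: "L holomorphic_on {s. Re s > 1 - e}"
    and exp_L: "\<And>s. s \<in> {s. Re s > 1 - e} \<Longrightarrow> exp (L s) = dirichlet_series f s"
    by (rule holomorphic_logarithm_exists[OF convex_halfspace_Re_gt open_halfspace_Re_gt F, where ?z0.0 = 1])
       (use nz e in auto)
  obtain c where "\<And>s. s \<in> {s. Re s > 1 - e} \<Longrightarrow> Re s > 1 \<Longrightarrow> L s = dirichlet_series f_primes s + log_remainder f_primes s + c"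
    using log_continues_prime_series[OF open_halfspace_Re_gt convex_halfspace_Re_gt L exp_L] by blast
  then have L_eq: "L s = dirichlet_series f_primes s + log_remainder f_primes s + c" if "Re s > 1" for s
    using that e by simp
  define BH where "BH = (\<Sum>n. 4 * real (Suc n) powr (- 3/2))"
  have BH: "norm (log_remainder f_primes s) \<le> BH" if "Re s \<ge> 3/4" for s
    unfolding BH_def by (rule norm_log_remainder_le[where g = f_primes, OF f_primes_1 f_primes_bound that])
  obtain C1 where C1: "\<And>n. n \<ge> 1 \<Longrightarrow> \<bar>sum f {1..n}\<bar> \<le> C1 * real n powr (1 - e)"
    using small_on_average_bound[OF small, of e] e \<epsilon> by auto
  define C2 where "C2 = C1 * (\<Sum>n. real (Suc n) powr (- 1 - e / 2))"
  have growth_F: "norm (exp (L s)) \<le> C2 * norm s" if "Re s \<ge> 1 - e / 2" for s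
    using norm_dirichlet_series_le[OF C1, of "e / 2" s] exp_L[of s] that e by (simp add: C2_def mult_ac)
  have B: "norm (L s) \<le> (\<Sum>n. real (Suc n) powr (- 2)) + BH + norm c" if s: "Re s = 2" for s
  proof -
    have "norm (dirichlet_series f_primes s) \<le> (\<Sum>n. real (Suc n) powr (- 2))"
      unfolding dirichlet_series_def
    proof (intro norm_suminf_le summable_Suc_powr)
      fix n
      have "norm (of_real (f_primes (Suc n)) * of_nat (Suc n) powr (- s) :: complex) = \<bar>f_primes (Suc n)\<bar> * real (Suc n) powr (- 2)"
        using s by (simp add: norm_mult norm_of_nat_powr del: of_nat_Suc)
      also have "\<dots> \<le> 1 * real (Suc n) powr (- 2)" using f_primes_bound[of "Suc n"] by (intro mult_right_mono) auto
      finally show "norm (of_real (f_primes (Suc n)) * of_nat (Suc n) powr (- s) :: complex) \<le> real (Suc n) powr (- 2)"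
        by simp
    qed simp
    then show ?thesis
      using L_eq[of s] s BH[of s] by (auto intro!: norm_triangle_le add_mono)
  qed
  obtain C3 where C3: "C3 \<ge> 0"
      "\<And>s. 1 - e / 2 / 2 \<le> Re s \<Longrightarrow> Re s \<le> 2 \<Longrightarrow> norm (L s) \<le> C3 * (1 + norm s)"
    by (rule log_linear_growth[OF L, of "e / 2" C2]) (use e growth_F B in auto)
  define G where "G = (\<lambda>z. L (1 + z) - log_remainder f_primes (1 + z) - c)"
  have G_hol: "G holomorphic_on {z. Re z > - e}"
    unfolding G_def
    by (intro holomorphic_intros holomorphic_on_compose_gen[OF _ L, unfolded o_def]
        holomorphic_on_compose_gen[OF _ log_remainder_hol, unfolded o_def]) (use e in auto)
  have G_eq: "G z = dirichlet_series f_primes (1 + z)" if "Re z > 0" for z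
    using L_eq[of "1 + z"] that by (simp add: G_def)
  have BH0: "BH \<ge> 0" using order_trans[OF norm_ge_zero BH[of 1]] by simp
  have G_growth: "norm (G z) \<le> (2 * C3 + BH + norm c) * (1 + norm z)" if "- (e / 4) \<le> Re z" "Re z \<le> 0" for z
  proof -
    have "norm (1 + z) \<le> 1 + norm z" using norm_triangle_ineq[of 1 z] by simp
    then have "1 + norm (1 + z) \<le> 2 * (1 + norm z)"
      using norm_ge_zero[of z] unfolding ring_distribs by linarith
    then have "C3 * (1 + norm (1 + z)) \<le> C3 * (2 * (1 + norm z))"
      using C3(1) by (rule mult_left_mono)
    moreover have "norm (L (1 + z)) \<le> C3 * (1 + norm (1 + z))" using C3(2)[of "1 + z"] that by simp
    ultimately have 1: "norm (L (1 + z)) \<le> 2 * C3 * (1 + norm z)" by (simp add: algebra_simps)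
    have 2: "norm (log_remainder f_primes (1 + z)) \<le> BH" using BH[of "1 + z"] that e by simp
    have "BH * 1 \<le> BH * (1 + norm z)" "norm c * 1 \<le> norm c * (1 + norm z)"
      using BH0 by (intro mult_left_mono; simp)+
    moreover have "norm (G z) \<le> norm (L (1 + z)) + norm (log_remainder f_primes (1 + z)) + norm c"
      unfolding G_def by (intro order_trans[OF norm_triangle_ineq4] add_mono) auto
    ultimately show ?thesis using 1 2 unfolding ring_distribs by linarith
  qed
  obtain K where K: "\<And>N. N \<ge> 1 \<Longrightarrow>
      norm (G 0 - of_real (\<Sum>n<N. f_primes (Suc n) / real (Suc n))) \<le> K * real N powr (- (e / 4 / 3))"
    by (rule newman_power_saving[OF f_primes_bound G_hol, where \<eta> = "e / 4"]) (use e G_eq G_growth in auto)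
  \<comment> \<open>\<open>F\<close> is bounded linearly up to \<open>1 - e / 2\<close>, its
    logarithm up to \<open>1 - e / 4\<close>, and Newman's argument keeps a third of the width
    \<open>e / 4\<close>.\<close>
  define \<theta> where "\<theta> = e / 4 / 3"
  have \<theta>: "0 < \<theta>" "\<theta> < 1" using e by (auto simp: \<theta>_def)
  have "\<bar>Re (G 0) - (\<Sum>n=1..N. f_primes n / real n)\<bar> \<le> K * real N powr (- \<theta>)" if N: "N \<ge> 1" for N
  proof -
    have "(\<Sum>n=1..N. f_primes n / real n) = (\<Sum>n<N. f_primes (Suc n) / real (Suc n))"
      by (rule sum.reindex_bij_witness[of _ Suc "\<lambda>n. n - 1"]) auto
    then have "Re (G 0) - (\<Sum>n=1..N. f_primes n / real n) = Re (G 0 - of_real (\<Sum>n<N. f_primes (Suc n) / real (Suc n)))"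
      by (simp only: minus_complex.simps Re_complex_of_real)
    then show ?thesis
      using order_trans[OF abs_Re_le_cmod K[OF N]] by (simp only: \<theta>_def)
  qed
  \<comment> \<open>The weights \<open>n\<close> undo the division by \<open>p\<close>: a rate for
    the sums of \<open>f p / p\<close> becomes a power saving for the sums of
    \<open>f p\<close>.\<close>
  then obtain C where C: "\<And>N. N \<ge> 1 \<Longrightarrow> \<bar>\<Sum>n=1..N. real n * (f_primes n / real n)\<bar> \<le> C * real N powr (1 - \<theta>)"
    using weighted_sum_power_saving[of "Re (G 0)" "\<lambda>n. f_primes n / real n" K \<theta>] \<theta> by blast
  have "(\<Sum>n=1..N. real n * (f_primes n / real n)) = sum f_primes {1..N}" for N
    by (intro sum.cong) auto
  then show ?thesis using that[OF \<theta>, of C] C by simp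
qed

lemma zero_free_imp_sign:
  assumes \<epsilon>: "0 < \<epsilon>" "\<epsilon> \<le> \<delta>" and nz: "\<And>s. Re s > 1 - \<epsilon> \<Longrightarrow> dirichlet_series f s \<noteq> 0"
  shows "\<exists>\<sigma>. 0 \<le> \<sigma> \<and> \<sigma> < 1 \<and> finitely_many_sign_changes (prime_partial_sum f \<sigma>)"
proof -
  obtain \<theta> C where \<theta>: "0 < \<theta>" "\<theta> < 1"
    and C: "\<And>N. N \<ge> 1 \<Longrightarrow> \<bar>sum f_primes {1..N}\<bar> \<le> C * real N powr (1 - \<theta>)"
    using prime_sum_power_saving[OF \<epsilon> nz] by blast
  have hol: "dirichlet_series f_primes holomorphic_on {s. Re s > 1 - \<theta>}"
    by (rule dirichlet_series_holomorphic[OF C]) (use \<theta> in auto)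
  show ?thesis
  proof (cases "\<exists>\<sigma>::real. 1 - \<theta> < \<sigma> \<and> \<sigma> < 1 \<and> dirichlet_series f_primes (of_real \<sigma>) \<noteq> 0")
    case True
    then obtain \<sigma> :: real where \<sigma>: "1 - \<theta> < \<sigma>" "\<sigma> < 1" "dirichlet_series f_primes (of_real \<sigma>) \<noteq> 0" by blast
    define T where "T = (\<lambda>n. f_primes (Suc n) * real (Suc n) powr (- \<sigma>))"
    have "(\<lambda>n. complex_of_real (T n)) sums dirichlet_series f_primes (of_real \<sigma>)"
    proof -
      have "complex_of_real (T n) = of_real (f_primes (Suc n)) * of_nat (Suc n) powr (- of_real \<sigma>)" for n
        using powr_of_real[of "real (Suc n)" "- \<sigma>"] by (simp add: T_def)
      then show ?thesis
        using dirichlet_series_sums[OF C, of "of_real \<sigma>"] \<sigma> \<theta> by simp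
    qed
    then have "(\<lambda>n. Re (complex_of_real (T n))) sums Re (dirichlet_series f_primes (of_real \<sigma>))"
      and Im: "(\<lambda>n. Im (complex_of_real (T n))) sums Im (dirichlet_series f_primes (of_real \<sigma>))"
      by (rule sums_Re, rule sums_Im)
    then have T: "T sums Re (dirichlet_series f_primes (of_real \<sigma>))" by simp
    \<comment> \<open>The terms are real, so the nonzero limit is real and has a sign.\<close>
    have "(\<lambda>n. 0 :: real) sums Im (dirichlet_series f_primes (of_real \<sigma>))" using Im by simp
    then have "Im (dirichlet_series f_primes (of_real \<sigma>)) = 0" using sums_zero by (rule sums_unique2)
    then have \<rho>: "Re (dirichlet_series f_primes (of_real \<sigma>)) \<noteq> 0" (is "?\<rho> \<noteq> 0")
      using \<sigma>(3) by (simp add: complex_eq_iff)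
    have pps: "prime_partial_sum f \<sigma> x = (\<Sum>n<nat \<lfloor>x\<rfloor>. T n)" if "x \<ge> 0" for x
    proof -
      have "(\<Sum>n=1..nat \<lfloor>x\<rfloor>. f_primes n * real n powr (- \<sigma>)) = (\<Sum>n<nat \<lfloor>x\<rfloor>. T n)"
        by (rule sum.reindex_bij_witness[of _ Suc "\<lambda>n. n - 1"]) (auto simp: T_def)
      then show ?thesis using prime_partial_sum_eq[OF that, of f \<sigma>] by (simp add: f_primes_def)
    qed
    have partial: "(\<lambda>n. \<Sum>k<n. T k) \<longlonglongrightarrow> ?\<rho>" using T by (simp add: sums_def)
    have "filterlim (\<lambda>x::real. nat \<lfloor>x\<rfloor>) sequentially at_top"
      by (intro filterlim_compose[OF filterlim_nat_sequentially filterlim_floor_sequentially])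
    from filterlim_compose[OF partial this]
    have "((\<lambda>x::real. \<Sum>k<nat \<lfloor>x\<rfloor>. T k) \<longlongrightarrow> ?\<rho>) at_top" .
    then have lim: "(prime_partial_sum f \<sigma> \<longlongrightarrow> ?\<rho>) at_top"
      by (rule Lim_transform_eventually)
         (rule eventually_mono[OF eventually_ge_at_top[of 0]], simp add: pps)
    have "finitely_many_sign_changes (prime_partial_sum f \<sigma>)"
    proof (cases "?\<rho> > 0")
      case True
      then have "eventually (\<lambda>x. prime_partial_sum f \<sigma> x > 0) at_top" using lim by (rule order_tendstoD[rotated])
      then obtain x0 where "\<And>x. x \<ge> x0 \<Longrightarrow> prime_partial_sum f \<sigma> x > 0" by (auto simp: eventually_at_top_linorder)
      then show ?thesis unfolding finitely_many_sign_changes_def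
        by (intro exI[of _ "max x0 1"]) (auto intro: less_imp_le)
    next
      case False
      then have "?\<rho> < 0" using \<rho> by simp
      then have "eventually (\<lambda>x. prime_partial_sum f \<sigma> x < 0) at_top" using lim by (rule order_tendstoD[rotated])
      then obtain x0 where "\<And>x. x \<ge> x0 \<Longrightarrow> prime_partial_sum f \<sigma> x < 0" by (auto simp: eventually_at_top_linorder)
      then show ?thesis unfolding finitely_many_sign_changes_def
        by (intro exI[of _ "max x0 1"]) (auto intro: less_imp_le)
    qed
    then show ?thesis using \<sigma> \<theta> by (intro exI[of _ \<sigma>]) auto
  next
    case False
    \<comment> \<open>Here \<open>P\<close> vanishes on a real segment, hence by the identity
      theorem on the half plane. All \<open>f p\<close> are then 0, every prime partial sum
      vanishes, and \<open>\<sigma> = 0\<close> serves as witness.\<close>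
    define U where "U = complex_of_real ` {1 - \<theta><..<1}"
    define \<xi> where "\<xi> = 1 - \<theta> / 2"
    have lp: "complex_of_real \<xi> islimpt U"
    proof -
      have "\<xi> islimpt {1 - \<theta><..<1}"
        using \<theta> by (intro interior_limit_point[OF subsetD[OF equalityD2[OF interior_open]]]) (auto simp: \<xi>_def)
      then show ?thesis unfolding U_def islimpt_approachable
        by (force simp: dist_of_real)
    qed
    have zero: "dirichlet_series f_primes s = 0" if "Re s > 1 - \<theta>" for s
    proof (rule analytic_continuation[OF hol open_halfspace_Re_gt _ _ _ lp])
      show "connected {s. Re s > 1 - \<theta>}" by (intro convex_connected convex_halfspace_Re_gt)
    qed (use False that \<theta> in \<open>auto simp: U_def \<xi>_def\<close>)
    have "f_primes n = 0" if "n \<ge> 1" for n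
      by (rule dirichlet_series_eq_0_imp[OF f_primes_bound _ that]) (use zero \<theta> in auto)
    then have "prime_partial_sum f 0 x = 0" if "x \<ge> 0" for x
      using prime_partial_sum_eq[OF that, of f 0] by (auto simp: f_primes_def intro!: sum.neutral)
    then show ?thesis
      by (intro exI[of _ 0]) (auto simp: finitely_many_sign_changes_def intro!: exI[of _ 1])
  qed
qed

section \<open>From an eventually constant sign to a zero-free half plane\<close>

context
  fixes \<sigma> :: real
  assumes \<sigma>: "0 \<le> \<sigma>" "\<sigma> < 1"
begin

definition prime_sum :: "nat \<Rightarrow> real" where "prime_sum N = (\<Sum>n=1..N. f_primes n * real n powr (- \<sigma>))"

definition prime_sum_const :: real where "prime_sum_const = 1 / (1 - \<sigma>) + 1"

text \<open>The total error of replacing each difference of consecutive powers by its first-order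
  term \<open>w * n powr (- w - 1)\<close> in the summation by parts.\<close>

definition abel_error :: "complex \<Rightarrow> complex" where
  "abel_error w = (\<Sum>n. of_real (prime_sum (Suc n)) * (of_nat (Suc n) powr (- w) - of_nat (Suc (Suc n)) powr (- w)
      - w * of_nat (Suc n) powr (- w - 1)))"

lemma prime_sum_bound:
  assumes "N \<ge> 1"
  shows "\<bar>prime_sum N\<bar> \<le> prime_sum_const * real N powr (1 - \<sigma>)"
proof -
  have "\<bar>prime_sum N\<bar> \<le> (\<Sum>n=1..N. \<bar>f_primes n * real n powr (- \<sigma>)\<bar>)" unfolding prime_sum_def by (rule sum_abs)
  also have "\<dots> \<le> (\<Sum>n=1..N. 1 * real n powr (- \<sigma>))"
    using f_primes_bound by (intro sum_mono) (auto simp: abs_mult intro!: mult_right_mono)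
  also have "\<dots> = (\<Sum>n<N. real (Suc n) powr ((1 - \<sigma>) - 1))"
    by (rule sum.reindex_bij_witness[of _ Suc "\<lambda>n. n - 1"]) auto
  also have "\<dots> \<le> real N powr (1 - \<sigma>) * (1 / (1 - \<sigma>) + 1 / real N)"
    using \<sigma> assms by (intro sum_powr_head_le) auto
  also have "\<dots> \<le> real N powr (1 - \<sigma>) * prime_sum_const"
    unfolding prime_sum_const_def using assms by (intro mult_left_mono add_left_mono) auto
  finally show ?thesis by (simp add: mult.commute)
qed

lemma prime_sum_const_nonneg: "prime_sum_const \<ge> 0"
  using \<sigma> by (simp add: prime_sum_const_def)

lemma prime_sum_sum_bound: "N \<ge> 1 \<Longrightarrow> \<bar>sum prime_sum {1..N}\<bar> \<le> prime_sum_const * real N powr (2 - \<sigma>)"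
  using abs_sum_powr_le[of prime_sum prime_sum_const "1 - \<sigma>" N] prime_sum_bound \<sigma> by simp

text \<open>\<open>prime_sum n\<close> is at most of order \<open>n powr (1 - \<sigma>)\<close> and
  the second-order error of order \<open>n powr (- Re w - 2)\<close>. Their product is summable for
  \<open>Re w > - \<sigma>\<close>, which for \<open>w = s - \<sigma>\<close> means
  \<open>Re s > 0\<close>.\<close>

lemma abel_error_term_le:
  assumes "Re w > - \<sigma>"
  shows "norm (of_real (prime_sum (Suc n)) * (of_nat (Suc n) powr (- w) - of_nat (Suc (Suc n)) powr (- w)
      - w * of_nat (Suc n) powr (- w - 1)))
    \<le> prime_sum_const * (norm w * norm (w + 1)) * real (Suc n) powr (- 1 - \<sigma> - Re w)"
proof -
  have "norm (of_real (real (Suc n)) powr (- w) - of_real (real (Suc (Suc n))) powr (- w)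
      - w * of_real (real (Suc n)) powr (- w - 1) * of_real (real (Suc (Suc n)) - real (Suc n)))
    \<le> norm w * norm (w + 1) * real (Suc n) powr (- Re w - 2) * (real (Suc (Suc n)) - real (Suc n))\<^sup>2"
    using assms \<sigma> by (intro norm_powr_taylor_le) auto
  then have "norm (of_nat (Suc n) powr (- w) - of_nat (Suc (Suc n)) powr (- w)
      - w * of_nat (Suc n) powr (- w - 1)) \<le> norm w * norm (w + 1) * real (Suc n) powr (- Re w - 2)"
    by simp
  then have "\<bar>prime_sum (Suc n)\<bar> * norm (of_nat (Suc n) powr (- w) - of_nat (Suc (Suc n)) powr (- w)
      - w * of_nat (Suc n) powr (- w - 1))
    \<le> (prime_sum_const * real (Suc n) powr (1 - \<sigma>)) * (norm w * norm (w + 1) * real (Suc n) powr (- Re w - 2))"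
    using prime_sum_bound[of "Suc n"] prime_sum_const_nonneg by (intro mult_mono) auto
  also have "\<dots> = prime_sum_const * (norm w * norm (w + 1)) * (real (Suc n) powr (1 - \<sigma>) * real (Suc n) powr (- Re w - 2))"
    by (simp only: mult_ac)
  also have "real (Suc n) powr (1 - \<sigma>) * real (Suc n) powr (- Re w - 2) = real (Suc n) powr (- 1 - \<sigma> - Re w)"
    by (subst powr_add[symmetric]) (simp add: algebra_simps)
  finally show ?thesis by (simp only: norm_mult norm_of_real)
qed

lemma abel_error_summable:
  assumes "Re w > - \<sigma>"
  shows "summable (\<lambda>n. of_real (prime_sum (Suc n)) * (of_nat (Suc n) powr (- w) - of_nat (Suc (Suc n)) powr (- w)
      - w * of_nat (Suc n) powr (- w - 1)))"
  by (rule summable_comparison_test'[OF summable_mult[OF summable_Suc_powr[of "- 1 - \<sigma> - Re w"],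
        of "prime_sum_const * (norm w * norm (w + 1))"], of 0])
     (use abel_error_term_le[OF assms] assms in auto)

lemma abel_error_holomorphic: "abel_error holomorphic_on {w. Re w > - \<sigma>}"
  unfolding abel_error_def
proof (rule holomorphic_suminf)
  show "open {w. Re w > - \<sigma>}" by (rule open_halfspace_Re_gt)
  fix z assume "z \<in> {w. Re w > - \<sigma>}"
  define d where "d = (Re z + \<sigma>) / 2"
  have d: "d > 0" using \<open>z \<in> _\<close> by (simp add: d_def)
  define M where "M = prime_sum_const * ((norm z + d) * (norm z + d + 1))"
  have "norm (of_real (prime_sum (Suc n)) * (of_nat (Suc n) powr (- y) - of_nat (Suc (Suc n)) powr (- y)
      - y * of_nat (Suc n) powr (- y - 1))) \<le> M * real (Suc n) powr (- 1 - d)"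
    if y: "y \<in> ball z d" "Re y > - \<sigma>" for n y
  proof -
    have zy: "norm (z - y) < d" using y by (simp add: dist_norm)
    then have 1: "norm y \<le> norm z + d" using norm_triangle_ineq2[of y z] by (simp add: norm_minus_commute)
    then have 2: "norm (y + 1) \<le> norm z + d + 1" using norm_triangle_ineq[of y 1] by simp
    have "Re z - Re y \<le> norm (z - y)" using complex_Re_le_cmod[of "z - y"] by simp
    then have "- 1 - \<sigma> - Re y \<le> - 1 - d" using zy by (simp add: d_def field_simps)
    then have "prime_sum_const * (norm y * norm (y + 1)) * real (Suc n) powr (- 1 - \<sigma> - Re y) \<le> M * real (Suc n) powr (- 1 - d)"
      unfolding M_def using prime_sum_const_nonneg 1 2 d
      by (intro mult_mono powr_mono mult_nonneg_nonneg add_nonneg_nonneg) auto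
    then show ?thesis using abel_error_term_le[OF y(2), of n] by linarith
  qed
  moreover have "summable (\<lambda>n. M * real (Suc n) powr (- 1 - d))"
    using d by (intro summable_mult summable_Suc_powr) auto
  ultimately show "\<exists>d>0. \<exists>M. summable M \<and> (\<forall>n. \<forall>y\<in>ball z d \<inter> {w. - \<sigma> < Re w}.
     norm (of_real (prime_sum (Suc n)) * (of_nat (Suc n) powr (- y) - of_nat (Suc (Suc n)) powr (- y)
      - y * of_nat (Suc n) powr (- y - 1))) \<le> M n)"
    using d by (intro exI[of _ d] conjI exI[of _ "\<lambda>n. M * real (Suc n) powr (- 1 - d)"]) auto
qed (auto intro!: holomorphic_intros simp del: of_nat_Suc)

text \<open>Summation by parts turns the prime series into a genuine Dirichlet series with coefficients
  \<open>prime_sum n\<close>, to which Landau's theorem applies, up to an error holomorphic on \<open>Re s > 0\<close>.\<close>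

lemma prime_series_eq_partial_sums:
  assumes "Re s > 1"
  shows "dirichlet_series f_primes s = (s - of_real \<sigma>) * dirichlet_series prime_sum (s + of_real (1 - \<sigma>)) + abel_error (s - of_real \<sigma>)"
proof -
  define w where "w = s - of_real \<sigma>"
  have w: "Re w > 1 - \<sigma>" using assms by (simp add: w_def)
  define b where "b = (\<lambda>n. f_primes n * real n powr (- \<sigma>))"
  have Ab: "sum b {1..N} = prime_sum N" for N by (simp add: prime_sum_def b_def)
  have "dirichlet_series f_primes s = dirichlet_series b w"
    using dirichlet_series_shift[of f_primes \<sigma> w] by (simp add: b_def w_def)
  also have "\<dots> = (\<Sum>n. of_real (prime_sum (Suc n)) * (of_nat (Suc n) powr (- w) - of_nat (Suc (Suc n)) powr (- w)))"
    by (rule dirichlet_series_abel[of b prime_sum_const "1 - \<sigma>" w, unfolded Ab]) (use prime_sum_bound \<sigma> w in auto)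
  also have "\<dots> = (\<Sum>n. w * (of_real (prime_sum (Suc n)) * of_nat (Suc n) powr (- (w + 1)))
      + of_real (prime_sum (Suc n)) * (of_nat (Suc n) powr (- w) - of_nat (Suc (Suc n)) powr (- w)
      - w * of_nat (Suc n) powr (- w - 1)))"
  proof (intro suminf_cong)
    have eq: "- (w + 1) = - w - 1" by simp
    show "complex_of_real (prime_sum (Suc n)) * (of_nat (Suc n) powr (- w) - of_nat (Suc (Suc n)) powr (- w))
      = w * (of_real (prime_sum (Suc n)) * of_nat (Suc n) powr (- (w + 1)))
      + of_real (prime_sum (Suc n)) * (of_nat (Suc n) powr (- w) - of_nat (Suc (Suc n)) powr (- w)
      - w * of_nat (Suc n) powr (- w - 1))" for n
      unfolding eq by (simp add: algebra_simps)
  qed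
  also have "\<dots> = (\<Sum>n. w * (of_real (prime_sum (Suc n)) * of_nat (Suc n) powr (- (w + 1)))) + abel_error w"
    unfolding abel_error_def
    using dirichlet_series_sums[OF prime_sum_sum_bound, of "w + 1"] w \<sigma>
    by (intro suminf_add[symmetric] summable_mult abel_error_summable) (auto simp: sums_iff)
  also have "(\<Sum>n. w * (of_real (prime_sum (Suc n)) * of_nat (Suc n) powr (- (w + 1)))) = w * dirichlet_series prime_sum (w + 1)"
    unfolding dirichlet_series_def
    using dirichlet_series_sums[OF prime_sum_sum_bound, of "w + 1"] w \<sigma>
    by (intro suminf_mult) (auto simp: sums_iff)
  finally show ?thesis by (simp add: w_def algebra_simps)
qed

text \<open>The coefficients \<open>prime_sum n\<close> give absolute convergence a priori for real
  part above \<open>2 - \<sigma>\<close>. This boundary point corresponds to \<open>s = 1\<close>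
  after the shift by \<open>1 - \<sigma>\<close>, exactly where \<open>F 1 \<noteq> 0\<close>
  provides the continuation that Landau's theorem needs.\<close>

lemma partial_sums_series_continues:
  assumes nz: "dirichlet_series f 1 \<noteq> 0" and "\<delta> > 0"
    and sign: "\<kappa> = 1 \<or> \<kappa> = (- 1 :: real)" "\<And>n. n \<ge> n0 \<Longrightarrow> \<kappa> * prime_sum n \<ge> 0"
  obtains \<epsilon> D where "0 < \<epsilon>" "\<epsilon> \<le> \<delta>" "\<epsilon> \<le> 1/4" "D holomorphic_on {s. Re s > 1 - \<epsilon>}"
    "\<And>s. Re s > 1 \<Longrightarrow> D s = dirichlet_series prime_sum (s + of_real (1 - \<sigma>))"
proof -
  \<comment> \<open>The caps serve \<open>F\<close>, the log remainder, and the division by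
    \<open>s - \<sigma>\<close>, which must not vanish near 1.\<close>
  define d0 where "d0 = min (min \<delta> (1/4)) (1 - \<sigma>)"
  have d0: "0 < d0" "d0 \<le> \<delta>" "d0 \<le> 1/4" "d0 \<le> 1 - \<sigma>" using \<open>\<delta> > 0\<close> \<sigma> by (auto simp: d0_def min_def)
  have F: "dirichlet_series f holomorphic_on {s. Re s > 1 - d0}" using f_holomorphic[of d0] d0 by simp
  have "continuous_on {s. Re s > 1 - d0} (dirichlet_series f)" using F by (rule holomorphic_on_imp_continuous_on)
  then obtain e where e: "e > 0" "\<And>s. dist 1 s < e \<Longrightarrow> s \<in> {s. Re s > 1 - d0} \<Longrightarrow> dirichlet_series f s \<noteq> 0"
    using continuous_on_avoid[of "{s. Re s > 1 - d0}" "dirichlet_series f" 1 0] nz d0 by auto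
  define \<rho> where "\<rho> = min e d0"
  have \<rho>: "0 < \<rho>" "\<rho> \<le> e" "\<rho> \<le> d0" using e d0 by (auto simp: \<rho>_def)
  have ball_Re: "Re s > 1 - \<rho>" if "s \<in> ball 1 \<rho>" for s
    using that abs_Re_le_cmod[of "1 - s"] by (simp add: dist_norm)
  have sub: "ball 1 \<rho> \<subseteq> {s. Re s > 1 - d0}" using ball_Re \<rho> by force
  obtain L where L: "L holomorphic_on ball 1 \<rho>" and exp_L: "\<And>s. s \<in> ball 1 \<rho> \<Longrightarrow> exp (L s) = dirichlet_series f s"
    by (rule holomorphic_logarithm_exists[OF convex_ball open_ball holomorphic_on_subset[OF F sub], where ?z0.0 = 1])
       (use e(2) \<rho> sub in auto)
  obtain c where L_eq: "\<And>s. s \<in> ball 1 \<rho> \<Longrightarrow> Re s > 1 \<Longrightarrow> L s = dirichlet_series f_primes s + log_remainder f_primes s + c"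
    using log_continues_prime_series[OF open_ball convex_ball L exp_L] by blast
  \<comment> \<open>\<open>A1\<close> is the part of constant sign, made nonnegative by
    \<open>\<kappa>\<close>; \<open>A2\<close> holds the finitely many exceptional coefficients,
    whose series needs no continuation.\<close>
  define A1 where "A1 = (\<lambda>n. if n \<ge> n0 then \<kappa> * prime_sum n else 0)"
  define A2 where "A2 = (\<lambda>n. if n \<ge> n0 then 0 else prime_sum n)"
  have A1_bound: "\<bar>A1 n\<bar> \<le> prime_sum_const * real n powr (1 - \<sigma>)" if "n \<ge> 1" for n
    using prime_sum_bound[OF that] prime_sum_const_nonneg sign(1) by (auto simp: A1_def abs_mult)
  have A1_nonneg: "A1 n \<ge> 0" for n using sign(2) by (simp add: A1_def)
  have A1_sum: "\<bar>sum A1 {1..N}\<bar> \<le> prime_sum_const * real N powr (2 - \<sigma>)" if "N \<ge> 1" for N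
    using abs_sum_powr_le[of A1 prime_sum_const "1 - \<sigma>" N] A1_bound \<sigma> that by simp
  have A2_sum: "\<bar>sum A2 {1..N}\<bar> \<le> (\<Sum>n<n0. \<bar>prime_sum n\<bar>) * real N powr 0" if "N \<ge> 1" for N
  proof -
    have "\<bar>sum A2 {1..N}\<bar> \<le> (\<Sum>n=1..N. \<bar>A2 n\<bar>)" by (rule sum_abs)
    also have "\<dots> \<le> (\<Sum>n<max n0 (Suc N). \<bar>A2 n\<bar>)" by (intro sum_mono2) auto
    also have "\<dots> = (\<Sum>n<n0. \<bar>prime_sum n\<bar>)"
      by (intro sum.mono_neutral_cong_right) (auto simp: A2_def)
    finally show ?thesis using that by simp
  qed
  have A2_hol: "dirichlet_series A2 holomorphic_on {s. Re s > 0}"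
    by (rule dirichlet_series_holomorphic[OF A2_sum]) auto
  have prime_sum_split: "dirichlet_series prime_sum s = of_real \<kappa> * dirichlet_series A1 s + dirichlet_series A2 s" if "Re s > 2 - \<sigma>" for s
  proof -
    have "(\<lambda>n. of_real \<kappa> * (of_real (A1 (Suc n)) * of_nat (Suc n) powr (- s)) + of_real (A2 (Suc n)) * of_nat (Suc n) powr (- s))
        sums (of_real \<kappa> * dirichlet_series A1 s + dirichlet_series A2 s)"
      using that \<sigma> by (intro sums_add sums_mult dirichlet_series_sums[OF A1_sum] dirichlet_series_sums[OF A2_sum]) auto
    moreover have "of_real \<kappa> * (of_real (A1 (Suc n)) * of_nat (Suc n) powr (- s)) + of_real (A2 (Suc n)) * of_nat (Suc n) powr (- s)
        = complex_of_real (prime_sum (Suc n)) * of_nat (Suc n) powr (- s)" for n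
      using sign(1) by (auto simp: A1_def A2_def)
    ultimately show ?thesis by (simp add: dirichlet_series_def sums_iff)
  qed
  \<comment> \<open>The summation by parts identity solved for the series of \<open>A1\<close>, with
    \<open>L - log_remainder f_primes - c\<close> in place of the prime series and
    \<open>\<kappa>\<close> as its own inverse.\<close>
  define G where "G = (\<lambda>s'. of_real \<kappa> * ((L (s' - of_real (1 - \<sigma>)) - log_remainder f_primes (s' - of_real (1 - \<sigma>)) - c - abel_error (s' - 1))
        / (s' - 1) - dirichlet_series A2 s'))"
  \<comment> \<open>The centre lies \<open>\<rho> / 3\<close> to the right of
    \<open>2 - \<sigma>\<close>; adding the radius \<open>2 * \<rho> / 3\<close> gives
    \<open>\<rho>\<close>, so the shifted ball stays in the domain of \<open>L\<close>. Moving left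
    by \<open>\<rho> / 2\<close> ends \<open>\<rho> / 6\<close> beyond \<open>2 - \<sigma>\<close>,
    the final width.\<close>
  define b where "b = 1 + \<rho> / 3 + (1 - \<sigma>)"
  define r where "r = 2 * \<rho> / 3"
  have shift: "s' - of_real (1 - \<sigma>) \<in> ball 1 \<rho>" if "s' \<in> ball (of_real b) r" for s' :: complex
  proof -
    have eq: "1 - (s' - of_real (1 - \<sigma>)) = (of_real b - s') - of_real (\<rho> / 3)" by (simp add: b_def)
    have "norm (1 - (s' - of_real (1 - \<sigma>))) \<le> norm (of_real b - s') + \<rho> / 3"
      unfolding eq using norm_triangle_ineq4[of "of_real b - s'" "complex_of_real (\<rho> / 3)"] \<rho> by simp
    then show ?thesis using that by (simp add: dist_norm r_def)
  qed
  have summ: "summable (\<lambda>n. A1 (Suc n) * real (Suc n) powr (- (b - \<rho> / 2)))"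
  proof (rule landau_dirichlet_series[where c = "2 - \<sigma>" and G = G and r = r])
    show "2 - \<sigma> < b" using \<rho> by (simp add: b_def)
    show "0 \<le> \<rho> / 2" "\<rho> / 2 < r" using \<rho> by (auto simp: r_def)
    show "summable (\<lambda>n. A1 (Suc n) * real (Suc n) powr (- x))" if "x > 2 - \<sigma>" for x
    proof (rule summable_comparison_test'[of "\<lambda>n. prime_sum_const * real (Suc n) powr (1 - \<sigma> - x)" 0])
      show "summable (\<lambda>n. prime_sum_const * real (Suc n) powr (1 - \<sigma> - x))"
        using that by (intro summable_mult summable_Suc_powr) auto
      fix n
      have "norm (A1 (Suc n) * real (Suc n) powr (- x)) = \<bar>A1 (Suc n)\<bar> * real (Suc n) powr (- x)"
        by (simp add: abs_mult)
      also have "\<dots> \<le> (prime_sum_const * real (Suc n) powr (1 - \<sigma>)) * real (Suc n) powr (- x)"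
        by (intro mult_right_mono A1_bound) auto
      also have "\<dots> = prime_sum_const * real (Suc n) powr (1 - \<sigma> - x)"
        by (simp add: powr_add[symmetric] mult.assoc)
      finally show "norm (A1 (Suc n) * real (Suc n) powr (- x)) \<le> prime_sum_const * real (Suc n) powr (1 - \<sigma> - x)" .
    qed
    have "s' - of_real (1 - \<sigma>) \<in> {s. Re s > 3/4} \<and> s' - 1 \<in> {s. Re s > - \<sigma>} \<and> s' \<noteq> 1 \<and> Re s' > 0"
      if "s' \<in> ball (of_real b) r" for s' :: complex
    proof -
      have "Re (s' - of_real (1 - \<sigma>)) > 1 - \<rho>" by (rule ball_Re[OF shift[OF that]])
      then have "Re s' > 2 - \<sigma> - d0" using \<rho> by simp
      then show ?thesis using d0 \<sigma> by auto
    qed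
    then show "G holomorphic_on ball (of_real b) r"
      unfolding G_def
      by (intro holomorphic_intros holomorphic_on_compose_gen[OF _ L, unfolded o_def]
          holomorphic_on_compose_gen[OF _ log_remainder_hol, unfolded o_def]
          holomorphic_on_compose_gen[OF _ abel_error_holomorphic, unfolded o_def]
          holomorphic_on_subset[OF A2_hol]) (use shift in auto)
    show "G s' = dirichlet_series A1 s'" if s': "s' \<in> ball (of_real b) r" "Re s' > 2 - \<sigma>" for s'
    proof -
      define s where "s = s' - of_real (1 - \<sigma>)"
      have s: "s \<in> ball 1 \<rho>" "Re s > 1" using shift[OF s'(1)] s'(2) by (auto simp: s_def)
      have ne: "s' - 1 \<noteq> 0" using s'(2) \<sigma> by auto
      have "s - of_real \<sigma> = s' - 1" "s + of_real (1 - \<sigma>) = s'" by (simp_all add: s_def)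
      then have L_s: "L s - log_remainder f_primes s - c = (s' - 1) * dirichlet_series prime_sum s' + abel_error (s' - 1)"
        using L_eq[OF s] prime_series_eq_partial_sums[OF s(2)] by simp
      have "G s' = of_real \<kappa> * ((L s - log_remainder f_primes s - c - abel_error (s' - 1)) / (s' - 1) - dirichlet_series A2 s')"
        by (simp only: G_def s_def)
      then have "G s' = of_real \<kappa> * (dirichlet_series prime_sum s' - dirichlet_series A2 s')"
        using ne by (simp add: L_s)
      also have "\<dots> = of_real (\<kappa> * \<kappa>) * dirichlet_series A1 s'"
        using prime_sum_split[OF s'(2)] by simp
      also have "\<kappa> * \<kappa> = 1" using sign(1) by auto
      finally show ?thesis by simp
    qed
  qed (use A1_nonneg in auto)
  define x1 where "x1 = b - \<rho> / 2"
  \<comment> \<open>Convergence at \<open>x1\<close> bounds the partial sums of the weighted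
    coefficients by a constant, so their series is holomorphic on \<open>Re s > 0\<close>; shifting
    by \<open>x1\<close> returns to \<open>A1\<close>.\<close>
  define a1 where "a1 = (\<lambda>n. A1 n * real n powr (- x1))"
  have a1_sum: "\<bar>sum a1 {1..N}\<bar> \<le> (\<Sum>n. a1 (Suc n)) * real N powr 0" if "N \<ge> 1" for N
  proof -
    have "sum a1 {1..N} = (\<Sum>n<N. a1 (Suc n))"
      by (rule sum.reindex_bij_witness[of _ Suc "\<lambda>n. n - 1"]) auto
    also have "\<dots> \<le> (\<Sum>n. a1 (Suc n))"
      using summ A1_nonneg by (intro sum_le_suminf) (auto simp: a1_def x1_def)
    finally have "sum a1 {1..N} \<le> (\<Sum>n. a1 (Suc n))" .
    moreover have "sum a1 {1..N} \<ge> 0" using A1_nonneg by (intro sum_nonneg) (auto simp: a1_def)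
    ultimately show ?thesis using that by simp
  qed
  have a1_hol: "dirichlet_series a1 holomorphic_on {s. Re s > 0}"
    by (rule dirichlet_series_holomorphic[OF a1_sum]) auto
  have a1_eq: "dirichlet_series a1 s = dirichlet_series A1 (s + of_real x1)" for s
    unfolding a1_def by (rule dirichlet_series_shift)
  define D where "D = (\<lambda>s. of_real \<kappa> * dirichlet_series a1 (s + of_real (1 - \<sigma>) - of_real x1) + dirichlet_series A2 (s + of_real (1 - \<sigma>)))"
  show ?thesis
  proof (rule that[of "\<rho> / 6" D])
    have x1: "1 - \<sigma> - x1 = \<rho> / 6 - 1" by (simp add: x1_def b_def)
    have pos: "Re s + (1 - \<sigma>) - x1 > 0" "Re s + (1 - \<sigma>) > 0" if "Re s > 1 - \<rho> / 6" for s
      using that x1 d0 \<rho> by linarith+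
    show "D holomorphic_on {s. Re s > 1 - \<rho> / 6}"
      unfolding D_def
      by (intro holomorphic_intros holomorphic_on_compose_gen[OF _ a1_hol, unfolded o_def]
          holomorphic_on_compose_gen[OF _ A2_hol, unfolded o_def]) (use pos in auto)
    show "D s = dirichlet_series prime_sum (s + of_real (1 - \<sigma>))" if "Re s > 1" for s
      using prime_sum_split[of "s + of_real (1 - \<sigma>)"] that by (simp add: D_def a1_eq)
  qed (use \<rho> d0 in auto)
qed

lemma sign_imp_zero_free:
  assumes nz: "dirichlet_series f 1 \<noteq> 0" and "\<delta> > 0"
    and sign: "finitely_many_sign_changes (prime_partial_sum f \<sigma>)"
  shows "\<exists>\<epsilon>. 0 < \<epsilon> \<and> \<epsilon> \<le> \<delta> \<and> (\<forall>s. Re s > 1 - \<epsilon> \<longrightarrow> dirichlet_series f s \<noteq> 0)"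
proof -
  have prime_sum_eq: "prime_partial_sum f \<sigma> (real n) = prime_sum n" for n
    using prime_partial_sum_eq[of "real n" f \<sigma>] by (simp add: prime_sum_def f_primes_def)
  obtain x0 where "(\<forall>x\<ge>x0. prime_partial_sum f \<sigma> x \<ge> 0) \<or> (\<forall>x\<ge>x0. prime_partial_sum f \<sigma> x \<le> 0)"
    using sign by (auto simp: finitely_many_sign_changes_def)
  then obtain \<kappa> :: real where \<kappa>: "\<kappa> = 1 \<or> \<kappa> = - 1" "\<And>x. x \<ge> x0 \<Longrightarrow> \<kappa> * prime_partial_sum f \<sigma> x \<ge> 0"
    by (metis mult_1 mult_minus1 neg_0_le_iff_le)
  have "\<kappa> * prime_sum n \<ge> 0" if "n \<ge> nat \<lceil>x0\<rceil>" for n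
    using \<kappa>(2)[of "real n"] that prime_sum_eq[of n] by (simp add: nat_le_iff ceiling_le_iff)
  then obtain \<epsilon> D where \<epsilon>: "0 < \<epsilon>" "\<epsilon> \<le> \<delta>" "\<epsilon> \<le> 1/4"
    and D: "D holomorphic_on {s. Re s > 1 - \<epsilon>}"
      "\<And>s. Re s > 1 \<Longrightarrow> D s = dirichlet_series prime_sum (s + of_real (1 - \<sigma>))"
    using partial_sums_series_continues[OF nz \<open>\<delta> > 0\<close> \<kappa>(1), of "nat \<lceil>x0\<rceil>"] by blast
  \<comment> \<open>No logarithm of \<open>F\<close> is available on this half plane yet. The
    identity theorem is therefore applied to \<open>F\<close> and the exponential themselves,
    starting from \<open>Re s > 1\<close>.\<close>
  define P where "P = (\<lambda>s. (s - of_real \<sigma>) * D s + abel_error (s - of_real \<sigma>))"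
  have "(\<lambda>s. exp (P s + log_remainder f_primes s)) holomorphic_on {s. Re s > 1 - \<epsilon>}"
    unfolding P_def
    by (intro holomorphic_intros D holomorphic_on_compose_gen[OF _ abel_error_holomorphic, unfolded o_def]
        holomorphic_on_subset[OF log_remainder_hol]) (use \<epsilon> in auto)
  moreover have "dirichlet_series f holomorphic_on {s. Re s > 1 - \<epsilon>}"
    using f_holomorphic[of \<epsilon>] \<epsilon> by simp
  moreover have "dirichlet_series f z = exp (P z + log_remainder f_primes z)" if "z \<in> {s. Re s > 1}" for z
    using that f_eq_exp[of z] prime_series_eq_partial_sums[of z] D(2)[of z] by (simp add: P_def)
  moreover have "{s. Re s > 1} \<noteq> {}" by (auto intro!: exI[of _ 2])
  moreover have "connected {s. Re s > 1 - \<epsilon>}" by (intro convex_connected convex_halfspace_Re_gt)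
  moreover have "{s. Re s > 1} \<subseteq> {s. Re s > 1 - \<epsilon>}" using \<epsilon> by auto
  ultimately have "dirichlet_series f s = exp (P s + log_remainder f_primes s)" if "s \<in> {s. Re s > 1 - \<epsilon>}" for s
    using analytic_continuation_open[of "{s. Re s > 1}" "{s. Re s > 1 - \<epsilon>}" "dirichlet_series f"
        "\<lambda>s. exp (P s + log_remainder f_primes s)" s] that open_halfspace_Re_gt by blast
  then show ?thesis using \<epsilon> by (intro exI[of _ \<epsilon>]) auto
qed

end

end

theorem theorem1p3:
  fixes f :: "nat \<Rightarrow> real" and \<delta> :: real
  assumes "\<And>n. n \<ge> 1 \<Longrightarrow> f n \<in> {-1..1}"
    and "completely_multiplicative f"
    and "\<delta> > 0"
    and "small_on_average f \<delta>"
    and "dirichlet_series f 1 \<noteq> 0"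
  shows "(\<exists>\<epsilon>::real. 0 < \<epsilon> \<and> \<epsilon> \<le> \<delta> \<and>
            (\<forall>s::complex. Re s > 1 - \<epsilon> \<longrightarrow> dirichlet_series f s \<noteq> 0))
     \<longleftrightarrow> (\<exists>\<sigma>::real. 0 \<le> \<sigma> \<and> \<sigma> < 1 \<and> finitely_many_sign_changes (prime_partial_sum f \<sigma>))"
proof -
  interpret small_completely_multiplicative f \<delta>
    using assms(1,2,4) by unfold_locales (auto simp: abs_le_iff)
  show ?thesis
    using zero_free_imp_sign sign_imp_zero_free[OF _ _ assms(5,3)] by blast
qed

end
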